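(* Let $E$ be a uniformly smooth real Banach space, $D\subseteq E$ a nonempty closed convex subset, $T:D\to D$ a nonexpansive mapping with $F(T)\neq\emptyset$, and $x_0,u\in D$. Let $\{u_n\},\{v_n\}$ be bounded sequences in $D$ and let $\alpha_n,\gamma_n,\beta_n,\delta_n\ge0$ satisfy $0<\alpha_n+\gamma_n\le1$, $0<\beta_n+\delta_n\le1$, $\alpha_n\to0$, $\sum_{n=0}^\infty\alpha_n=\infty$, $\sum_{n=0}^\infty\gamma_n<\infty$, $\sum_{n=0}^\infty\delta_n<\infty$ and $\frac{\gamma_n}{\alpha_n+\gamma_n}\to0$. Define for $n\ge0$ $$y_n=\beta_nx_n+(1-\beta_n-\delta_n)Tx_n+\delta_nv_n,\qquad x_{n+1}=\alpha_nu+(1-\alpha_n-\gamma_n)Ty_n+\gamma_nu_n.$$ Assume $\{x_n\}$ is bounded and $\|Tx_n-x_n\|\to0$. Then $\{x_n\}$ converges strongly to $Q(u)$, where $u$ is regarded as the constant map $D\to D$, $x\mapsto u$.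
   Context: $F(T)=\{x\in D: Tx=x\}$ denotes the fixed point set of $T$. $\Pi_D$ denotes the set of contractions on $D$: maps $f:D\to D$ for which there is $\alpha\in(0,1)$ with $\|f(x)-f(y)\|\le\alpha\|x-y\|$ for all $x,y\in D$ (constant maps belong to $\Pi_D$). For $f\in\Pi_D$ and $t\in(0,1)$, let $x_t\in D$ be the unique solution of $x_t=tf(x_t)+(1-t)Tx_t$. When $E$ is uniformly smooth and $F(T)\neq\emptyset$, the strong limit $\lim_{t\to0^+}x_t$ exists and lies in $F(T)$ (a known result of Xu); the map $Q:\Pi_D\to F(T)$ is defined by $Q(f):=\lim_{t\to0^+}x_t$. *)

theory Defs
  imports "HOL-Analysis.Analysis"
begin

text \<open>Uniform smoothness: the modulus of smoothness
  rho(tau) = sup{(norm(x+y)+norm(x-y))/2 - 1 : norm x = 1, norm y = tau}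
  satisfies rho(tau)/tau -> 0 as tau -> 0+. Unfolded: for every eps > 0 there is
  delta > 0 such that rho(tau) <= eps * tau for all 0 < tau <= delta.\<close>
definition uniformly_smooth :: "'a::real_normed_vector itself \<Rightarrow> bool" where
  "uniformly_smooth _ \<longleftrightarrow>
     (\<forall>\<epsilon>>0. \<exists>\<delta>>0. \<forall>(x::'a) y. norm x = 1 \<longrightarrow> 0 < norm y \<longrightarrow> norm y \<le> \<delta> \<longrightarrow>
        (norm (x + y) + norm (x - y)) / 2 - 1 \<le> \<epsilon> * norm y)"

definition nonexpansive_on :: "'a::real_normed_vector set \<Rightarrow> ('a \<Rightarrow> 'a) \<Rightarrow> bool" where
  "nonexpansive_on D T \<longleftrightarrow> (\<forall>x\<in>D. \<forall>y\<in>D. norm (T x - T y) \<le> norm (x - y))"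

definition fixpoints :: "'a set \<Rightarrow> ('a \<Rightarrow> 'a) \<Rightarrow> 'a set" where
  "fixpoints D T = {x\<in>D. T x = x}"

definition implicit_point :: "'a::real_normed_vector set \<Rightarrow> ('a \<Rightarrow> 'a) \<Rightarrow> ('a \<Rightarrow> 'a) \<Rightarrow> real \<Rightarrow> 'a" where
  "implicit_point D T f t = (THE x. x \<in> D \<and> x = t *\<^sub>R f x + (1 - t) *\<^sub>R T x)"

definition Qmap :: "'a::real_normed_vector set \<Rightarrow> ('a \<Rightarrow> 'a) \<Rightarrow> ('a \<Rightarrow> 'a) \<Rightarrow> 'a" where
  "Qmap D T f = Lim (at_right 0) (implicit_point D T f)"

end

theory Submission
  imports Defs
begin

text \<open>Everything is phrased through norms alone, without the duality map. Uniform smoothness says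
  that norm (b + y) + norm (b - y) exceeds 2 * norm b by an arbitrarily small multiple of norm y,
  so it is contradicted as soon as norm (b + y) is at least norm b + norm y up to a constant factor
  while norm (b - y) is not much smaller than norm b. This single contradiction yields:
  directed families of bounded closed convex sets intersect (a substitute for reflexivity);
  diametral convex sets do not exist (normal structure), whence Kirk's fixed point theorem; and the
  asymptotic radius of the path x_t at a fixed point q minimising it is 0, so that x_t converges
  to q = Q(u). For the iteration, comparing x_n with x_t shows that moving from x_n - q in the
  direction u - q hardly increases the norm, and convexity of the norm along that line turns this
  into norm (x_(n+1) - q) \<le> (1 - \<alpha>_n) * norm (x_n - q) + \<alpha>_n * c + M * (\<gamma>_n + \<delta>_n) for
  arbitrarily small c > 0, unless the left-hand side is below c.\<close>

section \<open>Intersections of directed families of convex sets\<close>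

text \<open>Dividing by \<open>norm b\<close> reduces to the unit vectors of the definition, so that
  smallness of \<open>y\<close> becomes relative to \<open>norm b\<close>. For \<open>b = 0\<close>
  the bound forces \<open>y = 0\<close>.\<close>

lemma uniformly_smooth_scaled:
  assumes "uniformly_smooth TYPE('a::real_normed_vector)" "\<epsilon> > 0"
  obtains \<delta> where "\<delta> > 0"
    "\<And>(b::'a) y. norm y \<le> \<delta> * norm b \<Longrightarrow> norm (b + y) + norm (b - y) \<le> 2 * norm b + \<epsilon> * norm y"
proof -
  obtain \<delta> where \<delta>: "\<delta> > 0" "\<And>(x::'a) y. norm x = 1 \<Longrightarrow> 0 < norm y \<Longrightarrow> norm y \<le> \<delta> \<Longrightarrow>
        (norm (x + y) + norm (x - y)) / 2 - 1 \<le> \<epsilon>/2 * norm y"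
    using assms unfolding uniformly_smooth_def by (metis half_gt_zero)
  have "norm (b + y) + norm (b - y) \<le> 2 * norm b + \<epsilon> * norm y" if *: "norm y \<le> \<delta> * norm b" for b y :: 'a
  proof (cases "y = 0")
    case True
    then show ?thesis by simp
  next
    case False
    then have y: "norm y > 0" by simp
    have b: "norm b > 0"
      using * y \<delta>(1) by (metis mult_zero_right not_less norm_ge_zero order_less_le)
    define x where "x = b /\<^sub>R norm b"
    define z where "z = y /\<^sub>R norm b"
    have x: "b = norm b *\<^sub>R x" and z: "y = norm b *\<^sub>R z" using b by (auto simp: x_def z_def)
    have "norm x = 1" "0 < norm z" "norm z \<le> \<delta>"
      using b y * by (auto simp: x_def z_def divide_simps mult.commute)
    from \<delta>(2)[OF this] have "norm (x + z) + norm (x - z) \<le> 2 + \<epsilon> * norm z" by (simp add: field_simps)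
    then have "norm b * (norm (x + z) + norm (x - z)) \<le> norm b * (2 + \<epsilon> * norm z)"
      using b by (intro mult_left_mono) auto
    moreover have "norm (b + y) = norm b * norm (x + z)"
      by (subst x, subst z, subst scaleR_add_right[symmetric]) simp
    moreover have "norm (b - y) = norm b * norm (x - z)"
      by (subst x, subst z, subst scaleR_diff_right[symmetric]) simp
    moreover have "norm y = norm b * norm z" by (subst z) simp
    ultimately show ?thesis by (simp add: algebra_simps)
  qed
  with \<delta>(1) show ?thesis using that by blast
qed

text \<open>The vector on the right is \<open>1 + \<tau>\<close> times \<open>m - y0\<close>, where
  \<open>m\<close> is a convex combination of \<open>c\<close> and \<open>x\<close>, hence in
  \<open>C\<close>. This supplies the large norm in a smoothness contradiction.\<close>

lemma convex_combination_norm_less: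
  fixes c x y0 :: "'a::real_normed_vector"
  assumes "convex C" "c \<in> C" "x \<in> C" "\<And>c. c \<in> C \<Longrightarrow> r < norm (c - y0)" "\<tau> \<ge> 0"
  shows "(1 + \<tau>) * r < norm ((c - y0) + \<tau> *\<^sub>R (x - y0))"
proof -
  let ?m = "(1 / (1 + \<tau>)) *\<^sub>R c + (\<tau> / (1 + \<tau>)) *\<^sub>R x"
  have "?m \<in> C"
    using assms by (intro convexD) (auto simp: field_simps)
  then have "r < norm (?m - y0)" by (rule assms(4))
  then have "(1 + \<tau>) * r < (1 + \<tau>) * norm (?m - y0)"
    using assms(5) by (intro mult_strict_left_mono) auto
  also have "\<dots> = norm ((1 + \<tau>) *\<^sub>R (?m - y0))" using assms(5) by simp
  also have "(1 + \<tau>) *\<^sub>R (?m - y0) = (c - y0) + \<tau> *\<^sub>R (x - y0)"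
  proof -
    have "(1 + \<tau>) *\<^sub>R ?m = c + \<tau> *\<^sub>R x" using assms(5) by (simp add: scaleR_add_right)
    then show ?thesis by (simp add: algebra_simps)
  qed
  finally show ?thesis .
qed

text \<open>One centre serves all members but need not lie in any of them.\<close>

definition meets_balls :: "'a::real_normed_vector set set \<Rightarrow> real \<Rightarrow> 'a \<Rightarrow> bool" where
  "meets_balls \<C> r y \<longleftrightarrow> (\<forall>C\<in>\<C>. \<exists>c\<in>C. norm (c - y) \<le> r)"

definition directed_convex :: "'a::real_normed_vector set set \<Rightarrow> bool" where
  "directed_convex \<C> \<longleftrightarrow> \<C> \<noteq> {} \<and> (\<forall>C\<in>\<C>. C \<noteq> {} \<and> closed C \<and> convex C \<and> bounded C) \<and>
     (\<forall>A\<in>\<C>. \<forall>B\<in>\<C>. \<exists>C\<in>\<C>. C \<subseteq> A \<inter> B)"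

text \<open>Suppose the infimum \<rho> of the admissible radii is positive. Take a nearly optimal
  centre \<open>y0\<close> and a point \<open>x\<close> of a member near it. Moving the centre by
  \<open>\<tau> *\<^sub>R (x - y0)\<close> cannot beat \<rho>, so some \<open>c\<close> stays far
  from the new centre. With \<open>b = c - y0\<close> this keeps \<open>norm (b - y)\<close> near
  \<rho>, while convexity pushes \<open>norm (b + y)\<close> to about
  \<open>(1 + \<tau>) * \<rho>\<close>, against smoothness.\<close>

lemma uniformly_smooth_meets_small_balls:
  assumes us: "uniformly_smooth TYPE('a::real_normed_vector)"
    and dir: "directed_convex (\<C> :: 'a set set)" and "e > 0"
  shows "\<exists>y. meets_balls \<C> e y"
proof -
  define R where "R = {r. r \<ge> 0 \<and> (\<exists>y. meets_balls \<C> r y)}"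
  define \<rho> where "\<rho> = Inf R"
  have dirD: "\<And>C. C \<in> \<C> \<Longrightarrow> C \<noteq> {}" "\<And>C. C \<in> \<C> \<Longrightarrow> convex C" "\<And>C. C \<in> \<C> \<Longrightarrow> bounded C"
    "\<And>A B. A \<in> \<C> \<Longrightarrow> B \<in> \<C> \<Longrightarrow> \<exists>C\<in>\<C>. C \<subseteq> A \<inter> B" "\<C> \<noteq> {}"
    using dir unfolding directed_convex_def by auto
  have bdd: "bdd_below R" unfolding R_def by (rule bdd_belowI[of _ 0]) auto
  have Rne: "R \<noteq> {}"
  proof -
    obtain C0 where C0: "C0 \<in> \<C>" using dirD(5) by auto
    obtain y0 where y0: "y0 \<in> C0" using dirD(1)[OF C0] by auto
    have "meets_balls \<C> (diameter C0) y0"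
      unfolding meets_balls_def
    proof
      fix C assume C: "C \<in> \<C>"
      obtain C' where "C' \<in> \<C>" "C' \<subseteq> C \<inter> C0" using dirD(4)[OF C C0] by auto
      with dirD(1) obtain c where "c \<in> C" "c \<in> C0" by fastforce
      with diameter_bounded_bound[OF dirD(3)[OF C0] this(2) y0]
      show "\<exists>c\<in>C. norm (c - y0) \<le> diameter C0" by (auto simp: dist_norm)
    qed
    moreover have "diameter C0 \<ge> 0" by (rule diameter_ge_0[OF dirD(3)[OF C0]])
    ultimately show ?thesis unfolding R_def by blast
  qed
  have "\<rho> \<ge> 0" unfolding \<rho>_def using Rne by (intro cInf_greatest) (auto simp: R_def)
  have "\<rho> = 0"
  proof (rule ccontr)
    assume "\<rho> \<noteq> 0"
    with \<open>\<rho> \<ge> 0\<close> have \<rho>: "\<rho> > 0" by simp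
    obtain \<delta> where \<delta>: "\<delta> > 0"
      "\<And>(b::'a) y. norm y \<le> \<delta> * norm b \<Longrightarrow> norm (b + y) + norm (b - y) \<le> 2 * norm b + 1/2 * norm y"
      using uniformly_smooth_scaled[OF us, of "1/2"] by auto
    \<comment> \<open>Together with \<open>r0' \<le> 2 * r1\<close> the bound
      \<open>\<delta> / 2\<close> keeps the displacement below \<open>\<delta> * r1\<close>, as
      smoothness requires.\<close>
    define \<tau> where "\<tau> = min 1 (\<delta> / 2)"
    have \<tau>: "0 < \<tau>" "\<tau> \<le> 1" "\<tau> \<le> \<delta> / 2" using \<delta> by (auto simp: \<tau>_def)
    \<comment> \<open>The relative error \<open>\<tau> / 20\<close> on both sides of \<rho> costs
      less than the surplus of order \<open>\<tau> / 2\<close>; the final comparison becomes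
      \<open>12 * \<tau> < 3 * (\<tau> * \<tau>)\<close>, false for 0 < \<tau> \<le> 1.\<close>
    define r1 where "r1 = \<rho> * (1 - \<tau> / 20)"
    define r0' where "r0' = \<rho> * (1 + \<tau> / 20)"
    have r1: "0 < r1" "r1 < \<rho>" and "\<rho> < r0'" and r01: "r0' \<le> 2 * r1"
      using \<rho> \<tau> by (auto simp: r1_def r0'_def field_simps)
    have "Inf R < r0'" using \<open>\<rho> < r0'\<close> by (simp add: \<rho>_def)
    then obtain r0 where r0: "r0 \<in> R" "r0 < r0'"
      using cInf_lessD[OF Rne] by blast
    then obtain y0 where y0: "meets_balls \<C> r0 y0" unfolding R_def by auto
    have miss: "\<exists>C\<in>\<C>. \<forall>c\<in>C. r1 < norm (c - y)" for y
    proof (rule ccontr)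
      assume "\<not> ?thesis"
      then have "r1 \<in> R" using r1 unfolding R_def meets_balls_def by (auto simp: not_less)
      then have "\<rho> \<le> r1" unfolding \<rho>_def by (rule cInf_lower[OF _ bdd])
      with r1 show False by simp
    qed
    obtain C0 where C0: "C0 \<in> \<C>" "\<And>c. c \<in> C0 \<Longrightarrow> r1 < norm (c - y0)" using miss by blast
    obtain x where x: "x \<in> C0" "norm (x - y0) \<le> r0" using y0 C0 unfolding meets_balls_def by blast
    obtain C1 where C1: "C1 \<in> \<C>" "\<And>c. c \<in> C1 \<Longrightarrow> r1 < norm (c - (y0 + \<tau> *\<^sub>R (x - y0)))"
      using miss by blast
    \<comment> \<open>Directedness provides a single \<open>c\<close> that lies in
      \<open>C0\<close>, for the convexity bound, and in \<open>C1\<close>, which avoids the moved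
      ball.\<close>
    obtain C2 where C2: "C2 \<in> \<C>" "C2 \<subseteq> C0 \<inter> C1" using dirD(4)[OF C0(1) C1(1)] by auto
    obtain c where c: "c \<in> C2" "norm (c - y0) \<le> r0" using y0 C2 unfolding meets_balls_def by blast
    have lo1: "(1 + \<tau>) * r1 < norm ((c - y0) + \<tau> *\<^sub>R (x - y0))"
      using c C2 x C0 \<tau> dirD(2) by (intro convex_combination_norm_less[of C0]) auto
    have lo2: "r1 < norm ((c - y0) - \<tau> *\<^sub>R (x - y0))"
    proof -
      have "c \<in> C1" using c C2 by auto
      from C1(2)[OF this] show ?thesis by (simp add: algebra_simps)
    qed
    have "norm (\<tau> *\<^sub>R (x - y0)) \<le> \<tau> * r0'" using \<tau> x r0 by (auto intro!: mult_left_mono)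
    also have "\<dots> \<le> (\<delta> / 2) * (2 * r1)" using \<tau> r01 r1 \<open>\<rho> < r0'\<close> \<rho> by (intro mult_mono) auto
    also have "\<dots> \<le> \<delta> * norm (c - y0)" using C0(2)[of c] c C2 \<delta>(1) by auto
    finally have "norm ((c - y0) + \<tau> *\<^sub>R (x - y0)) + norm ((c - y0) - \<tau> *\<^sub>R (x - y0))
        \<le> 2 * norm (c - y0) + 1/2 * norm (\<tau> *\<^sub>R (x - y0))" by (rule \<delta>(2))
    also have "\<dots> \<le> 2 * r0' + 1/2 * (\<tau> * r0')"
      using c x r0 \<tau> by (auto intro!: add_mono mult_left_mono)
    finally have "(1 + \<tau>) * r1 + r1 < 2 * r0' + 1/2 * (\<tau> * r0')" using lo1 lo2 by linarith
    moreover have "(1 + \<tau>) * r1 + r1 = \<rho> * ((2 + \<tau>) * (1 - \<tau> / 20))"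
      "2 * r0' + 1/2 * (\<tau> * r0') = \<rho> * ((2 + \<tau> / 2) * (1 + \<tau> / 20))"
      unfolding r1_def r0'_def by (auto simp: field_simps)
    ultimately have "\<rho> * ((2 + \<tau>) * (1 - \<tau> / 20)) < \<rho> * ((2 + \<tau> / 2) * (1 + \<tau> / 20))"
      by simp
    then have "(2 + \<tau>) * (1 - \<tau> / 20) < (2 + \<tau> / 2) * (1 + \<tau> / 20)" using \<rho> by simp
    then have "12 * \<tau> < 3 * (\<tau> * \<tau>)" by (simp add: field_simps)
    moreover have "\<tau> * \<tau> \<le> \<tau>" using \<tau> by (simp add: mult_left_le)
    ultimately show False using \<tau> by linarith
  qed
  then have "Inf R < e" using \<open>e > 0\<close> by (simp add: \<rho>_def)
  then obtain r y where "r < e" "meets_balls \<C> r y"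
    using cInf_lessD[OF Rne] unfolding R_def by blast
  then have "meets_balls \<C> e y" unfolding meets_balls_def by (meson less_imp_le order_trans)
  then show ?thesis ..
qed

text \<open>Centres for the radii \<open>(1/2)^n\<close> are chosen successively, each for the
  family cut down to the preceding ball. They form a Cauchy sequence, and every closed member
  contains its limit.\<close>

lemma uniformly_smooth_directed_Inter:
  assumes us: "uniformly_smooth TYPE('a::banach)" and dir: "directed_convex (\<C> :: 'a set set)"
  shows "\<Inter>\<C> \<noteq> {}"
proof -
  have "\<exists>f. \<forall>n. meets_balls \<C> ((1/2)^n) (f n) \<and> dist (f n) (f (Suc n)) \<le> 2 * (1/2)^n"
  proof (rule dependent_nat_choice)
    show "\<exists>y. meets_balls \<C> ((1/2)^0) y"
      by (rule uniformly_smooth_meets_small_balls[OF us dir]) auto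
  next
    fix y n assume y: "meets_balls \<C> ((1/2)^n) y"
    \<comment> \<open>Members of the cut family are nonempty because the ball about \<open>y\<close>
      meets every member; cutting forces the next centre to be close to \<open>y\<close>.\<close>
    let ?\<C> = "(\<lambda>C. C \<inter> cball y ((1/2)^n)) ` \<C>"
    have "directed_convex ?\<C>"
      unfolding directed_convex_def
    proof (intro conjI ballI)
      show "?\<C> \<noteq> {}" using dir by (auto simp: directed_convex_def)
    next
      fix B assume "B \<in> ?\<C>"
      then obtain C where C: "C \<in> \<C>" "B = C \<inter> cball y ((1/2)^n)" by auto
      show "B \<noteq> {}" using y C by (fastforce simp: meets_balls_def dist_norm norm_minus_commute)
      show "closed B" "convex B" "bounded B"
        using C dir by (auto simp: directed_convex_def intro: convex_Int bounded_subset)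
    next
      fix A B assume "A \<in> ?\<C>" "B \<in> ?\<C>"
      then obtain A' B' where "A' \<in> \<C>" "A = A' \<inter> cball y ((1/2)^n)" "B' \<in> \<C>" "B = B' \<inter> cball y ((1/2)^n)"
        by auto
      moreover from this obtain C where "C \<in> \<C>" "C \<subseteq> A' \<inter> B'"
        using dir unfolding directed_convex_def by meson
      ultimately show "\<exists>C\<in>?\<C>. C \<subseteq> A \<inter> B"
        by (intro bexI[of _ "C \<inter> cball y ((1/2)^n)"]) auto
    qed
    from uniformly_smooth_meets_small_balls[OF us this, of "(1/2)^Suc n"]
    obtain z where z: "meets_balls ?\<C> ((1/2)^Suc n) z" by auto
    have "meets_balls \<C> ((1/2)^Suc n) z" using z by (auto simp: meets_balls_def)
    moreover have "dist y z \<le> 2 * (1/2)^n"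
    proof -
      obtain C where "C \<in> \<C>" using dir by (auto simp: directed_convex_def)
      with z obtain c where "dist y c \<le> (1/2)^n" "dist c z \<le> (1/2)^Suc n"
        by (auto simp: meets_balls_def dist_norm)
      moreover have "(1/2::real)^Suc n \<le> (1/2)^n" by simp
      ultimately show ?thesis using dist_triangle[of y z c] by linarith
    qed
    ultimately show "\<exists>z. meets_balls \<C> ((1/2)^Suc n) z \<and> dist y z \<le> 2 * (1/2)^n" by blast
  qed
  then obtain f where f: "\<And>n. meets_balls \<C> ((1/2)^n) (f n)" "\<And>n. dist (f n) (f (Suc n)) \<le> 2 * (1/2)^n"
    by blast
  have "summable (\<lambda>n. f (Suc n) - f n)"
  proof (rule summable_comparison_test')
    show "summable (\<lambda>n. 2 * (1/2::real)^n)" by (intro summable_mult summable_geometric) auto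
    show "norm (f (Suc n) - f n) \<le> 2 * (1/2)^n" if "n \<ge> 0" for n
      using f(2)[of n] by (simp add: dist_norm norm_minus_commute)
  qed
  then have "convergent f"
    by (simp add: summable_iff_convergent sum_lessThan_telescope convergent_diff_const_right_iff)
  then obtain y where y: "f \<longlonglongrightarrow> y" by (auto simp: convergent_def)
  have "y \<in> C" if C: "C \<in> \<C>" for C
  proof -
    have "\<forall>n. \<exists>c\<in>C. norm (c - f n) \<le> (1/2)^n" using f(1) C by (auto simp: meets_balls_def)
    then obtain c where c: "\<And>n. c n \<in> C" "\<And>n. norm (c n - f n) \<le> (1/2)^n" by metis
    have "(\<lambda>n. c n - f n) \<longlonglongrightarrow> 0"
    proof (rule Lim_null_comparison)
      show "eventually (\<lambda>n. norm (c n - f n) \<le> (1/2)^n) sequentially" using c by simp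
      show "(\<lambda>n. (1/2::real)^n) \<longlonglongrightarrow> 0" by (rule LIMSEQ_power_zero) simp
    qed
    from tendsto_add[OF this y] have "c \<longlonglongrightarrow> y" by simp
    moreover have "closed C" using C dir by (auto simp: directed_convex_def)
    ultimately show "y \<in> C" using c(1) closed_sequentially by blast
  qed
  then show ?thesis by blast
qed

section \<open>Normal structure and fixed points\<close>

text \<open>A single distance that falls short of \<open>d\<close> by \<open>e\<close> lowers the
  mean distance by \<open>e / card A\<close>. Contrapositively, a point almost at distance
  \<open>d\<close> from the centroid is so from each element.\<close>

lemma norm_centroid_le:
  fixes k :: "'a::real_normed_vector"
  assumes "finite A" "a0 \<in> A" "\<And>a. a \<in> A \<Longrightarrow> norm (k - a) \<le> d" "norm (k - a0) \<le> d - e"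
  shows "norm (k - (\<Sum>a\<in>A. (1 / card A) *\<^sub>R a)) \<le> d - e / card A"
proof -
  have card: "real (card A) > 0" using assms by (auto simp: card_gt_0_iff)
  have "k - (\<Sum>a\<in>A. (1 / card A) *\<^sub>R a) = (\<Sum>a\<in>A. (1 / card A) *\<^sub>R (k - a))"
    using card by (simp add: scaleR_diff_right sum_subtractf sum_constant_scaleR del: sum_constant)
  also have "norm \<dots> \<le> (\<Sum>a\<in>A. norm (k - a) / card A)"
    by (rule order_trans[OF norm_sum]) simp
  also have "\<dots> = (norm (k - a0) + (\<Sum>a\<in>A - {a0}. norm (k - a))) / card A"
    using assms by (simp add: sum.remove sum_divide_distrib[symmetric])
  also have "\<dots> \<le> ((d - e) + (\<Sum>a\<in>A - {a0}. d)) / card A"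
    using assms card by (intro divide_right_mono add_mono sum_mono) auto
  also have "(\<Sum>a\<in>A - {a0}. d) = (card A - 1) * d"
    using assms by simp
  also have "((d - e) + (card A - 1) * d) / card A = d - e / card A"
    using card by (simp add: field_simps)
  finally show ?thesis .
qed

text \<open>If \<open>K\<close> were diametral, the points almost diametral to a given finite set
  would have closed convex hulls forming a directed family. A common point \<open>x\<close> of these
  hulls, a point \<open>w\<close> far from \<open>x\<close> and a suitable \<open>z\<close>
  contradict smoothness at \<open>b = w - z\<close> with
  \<open>y = \<tau> *\<^sub>R (z - x)\<close>.\<close>

lemma uniformly_smooth_normal_structure:
  assumes us: "uniformly_smooth TYPE('a::banach)"
    and K: "closed K" "convex K" "bounded (K :: 'a set)" "diameter K > 0"
  obtains y r where "y \<in> K" "r < diameter K" "K \<subseteq> cball y r"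
proof (rule ccontr)
  define d where "d = diameter K"
  have d: "d > 0" using K by (simp add: d_def)
  have dle: "norm (a - b) \<le> d" if "a \<in> K" "b \<in> K" for a b
    using diameter_bounded_bound[OF K(3) that] by (simp add: d_def dist_norm)
  assume "\<not> thesis"
  with that have "\<And>y r. y \<in> K \<Longrightarrow> r < d \<Longrightarrow> \<not> K \<subseteq> cball y r" unfolding d_def by blast
  then have diam: "\<exists>k\<in>K. r < norm (k - y)" if "y \<in> K" "r < d" for y r
    using that by (fastforce simp: dist_norm norm_minus_commute)
  \<comment> \<open>Nonempty for finite \<open>A\<close>, since a point far from the centroid of
    \<open>A\<close> qualifies. The sets need not be convex, hence the passage to hulls.\<close>
  define Z where "Z A e = {z\<in>K. \<forall>y\<in>A. d - e \<le> norm (z - y)}" for A e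
  have Zne: "Z A e \<noteq> {}" if A: "finite A" "A \<subseteq> K" "e > 0" for A e
  proof (cases "A = {}")
    case True
    then show ?thesis using K(4) by (auto simp: Z_def)
  next
    case False
    have card: "real (card A) > 0" using A False by (auto simp: card_gt_0_iff)
    have "(\<Sum>a\<in>A. (1 / card A) *\<^sub>R a) \<in> K"
      using A card K(2) by (intro convex_sum) auto
    moreover have "d - e / card A < d" using card A by simp
    ultimately obtain k where k: "k \<in> K" "d - e / card A < norm (k - (\<Sum>a\<in>A. (1 / card A) *\<^sub>R a))"
      using diam by blast
    have "d - e \<le> norm (k - a0)" if "a0 \<in> A" for a0
    proof (rule ccontr)
      assume "\<not> ?thesis"
      then have "norm (k - (\<Sum>a\<in>A. (1 / card A) *\<^sub>R a)) \<le> d - e / card A"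
        using A k that by (intro norm_centroid_le[of A a0]) (auto intro: dle)
      with k show False by simp
    qed
    with k show ?thesis by (auto simp: Z_def)
  qed
  define \<C> where "\<C> = {closure (convex hull (Z A e)) | A e. finite A \<and> A \<subseteq> K \<and> e > 0}"
  have hullK: "closure (convex hull (Z A e)) \<subseteq> K" for A e
    using K by (intro closure_minimal hull_minimal) (auto simp: Z_def)
  have "directed_convex \<C>"
    unfolding directed_convex_def
  proof (intro conjI ballI)
    have "closure (convex hull (Z {} 1)) \<in> \<C>" unfolding \<C>_def by force
    then show "\<C> \<noteq> {}" by auto
  next
    fix C assume "C \<in> \<C>"
    then obtain A e where C: "C = closure (convex hull (Z A e))" "finite A" "A \<subseteq> K" "e > 0"
      unfolding \<C>_def by auto
    show "C \<noteq> {}" using Zne[OF C(2-4)] C(1) by simp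
    show "closed C" "convex C" using C(1) by auto
    show "bounded C" using hullK[of A e] K(3) C(1) by (auto intro: bounded_subset)
  next
    fix B C assume "B \<in> \<C>" "C \<in> \<C>"
    then obtain A e A' e' where *: "B = closure (convex hull (Z A e))" "finite A" "A \<subseteq> K" "e > 0"
      "C = closure (convex hull (Z A' e'))" "finite A'" "A' \<subseteq> K" "e' > 0"
      unfolding \<C>_def by blast
    have mono: "Z (A \<union> A') (min e e') \<subseteq> Z B f" if "B \<subseteq> A \<union> A'" "min e e' \<le> f" for B f
    proof
      fix z assume z: "z \<in> Z (A \<union> A') (min e e')"
      have "d - f \<le> norm (z - y)" if y: "y \<in> B" for y
      proof -
        have "d - min e e' \<le> norm (z - y)"
          using z y \<open>B \<subseteq> A \<union> A'\<close> unfolding Z_def by blast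
        with \<open>min e e' \<le> f\<close> show ?thesis by linarith
      qed
      with z show "z \<in> Z B f" unfolding Z_def by blast
    qed
    have "Z (A \<union> A') (min e e') \<subseteq> Z A e" "Z (A \<union> A') (min e e') \<subseteq> Z A' e'"
      by (rule mono; simp)+
    then have "closure (convex hull (Z (A \<union> A') (min e e'))) \<subseteq> B \<inter> C"
      using * by (simp add: closure_mono hull_mono)
    moreover have "closure (convex hull (Z (A \<union> A') (min e e'))) \<in> \<C>"
      unfolding \<C>_def using * by (auto intro!: exI[of _ "A \<union> A'"] exI[of _ "min e e'"])
    ultimately show "\<exists>D\<in>\<C>. D \<subseteq> B \<inter> C" by blast
  qed
  from uniformly_smooth_directed_Inter[OF us this] obtain x where x: "\<And>C. C \<in> \<C> \<Longrightarrow> x \<in> C" by auto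
  have xZ: "x \<in> closure (convex hull (Z A e))" if "finite A" "A \<subseteq> K" "e > 0" for A e
    using that x unfolding \<C>_def by blast
  have xK: "x \<in> K" using xZ[of "{}" 1] hullK by auto
  obtain \<delta> where \<delta>: "\<delta> > 0"
    "\<And>(b::'a) y. norm y \<le> \<delta> * norm b \<Longrightarrow> norm (b + y) + norm (b - y) \<le> 2 * norm b + 1/2 * norm y"
    using uniformly_smooth_scaled[OF us, of "1/2"] by auto
  define \<tau> where "\<tau> = min 1 (\<delta> / 2)"
  have \<tau>: "0 < \<tau>" "\<tau> \<le> 1" "\<tau> \<le> \<delta> / 2" using \<delta> by (auto simp: \<tau>_def)
  \<comment> \<open>The total loss \<open>\<eta> * (3 + \<tau>)\<close> is at most
    \<open>4 * \<eta>\<close>, which is below the surplus \<open>\<tau> * d / 2\<close>.\<close>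
  define \<eta> where "\<eta> = d * \<tau> / 10"
  have \<eta>: "0 < \<eta>" "\<eta> \<le> d / 2" using d \<tau> by (auto simp: \<eta>_def field_simps)
  obtain w where w: "w \<in> K" "d - \<eta> < norm (w - x)" using diam[OF xK, of "d - \<eta>"] \<eta> by auto
  \<comment> \<open>Chosen so that \<open>(1 + \<tau>) *\<^sub>R (z - m)\<close> is the negative of
    \<open>(w - z) - \<tau> *\<^sub>R (z - x)\<close>: a \<open>z\<close> far from \<open>m\<close>
    makes the latter long.\<close>
  define m where "m = (\<tau> / (1 + \<tau>)) *\<^sub>R x + (1 / (1 + \<tau>)) *\<^sub>R w"
  have m: "m \<in> K" unfolding m_def using K(2) xK w \<tau> by (intro convexD) (auto simp: field_simps)
  \<comment> \<open>Affine in \<open>y\<close>, with value \<open>w - x\<close> at \<open>x\<close>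
    and \<open>(w - z) + \<tau> *\<^sub>R (z - x)\<close> at \<open>z\<close>. Were it short on all
    of \<open>Z {w, m} \<eta>\<close>, it would be short on the closed convex hull and so at
    \<open>x\<close>, against the choice of \<open>w\<close>.\<close>
  let ?f = "\<lambda>y. (w - x) - (1 - \<tau>) *\<^sub>R (y - x)"
  have "\<exists>z\<in>Z {w, m} \<eta>. d - 2 * \<eta> < norm (?f z)"
  proof (rule ccontr)
    assume neg: "\<not> ?thesis"
    let ?S = "?f -` cball 0 (d - 2 * \<eta>)"
    have "continuous_on UNIV ?f" by (intro continuous_intros)
    then have "closed ?S" by (intro closed_vimage closed_cball)
    moreover have "convex ?S"
    proof (rule convexI)
      fix p q u v assume pq: "p \<in> ?S" "q \<in> ?S" "(0::real) \<le> u" "0 \<le> v" "u + v = 1"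
      then have u: "u = 1 - v" by simp
      have "?f (u *\<^sub>R p + v *\<^sub>R q) = u *\<^sub>R ?f p + v *\<^sub>R ?f q"
        unfolding u by (simp add: algebra_simps)
      moreover have "u *\<^sub>R ?f p + v *\<^sub>R ?f q \<in> cball 0 (d - 2 * \<eta>)"
        using pq by (intro convexD) auto
      ultimately show "u *\<^sub>R p + v *\<^sub>R q \<in> ?S" by simp
    qed
    moreover have "Z {w, m} \<eta> \<subseteq> ?S" using neg by auto
    ultimately have "closure (convex hull (Z {w, m} \<eta>)) \<subseteq> ?S"
      by (intro closure_minimal hull_minimal)
    moreover have "x \<in> closure (convex hull (Z {w, m} \<eta>))" using w m \<eta> by (intro xZ) auto
    ultimately have "x \<in> ?S" by blast
    then have "norm (w - x) \<le> d - 2 * \<eta>" by simp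
    with w \<eta> show False by simp
  qed
  then obtain z where z: "z \<in> K" "d - \<eta> \<le> norm (z - w)" "d - \<eta> \<le> norm (z - m)" "d - 2 * \<eta> < norm (?f z)"
    unfolding Z_def by auto
  have lo1: "d - 2 * \<eta> < norm ((w - z) + \<tau> *\<^sub>R (z - x))"
    using z(4) by (simp add: algebra_simps)
  have "(1 + \<tau>) * (d - \<eta>) \<le> (1 + \<tau>) * norm (z - m)"
    using z \<tau> by (intro mult_left_mono) auto
  also have "\<dots> = norm ((1 + \<tau>) *\<^sub>R (z - m))" using \<tau> by simp
  also have "(1 + \<tau>) *\<^sub>R (z - m) = - ((w - z) - \<tau> *\<^sub>R (z - x))"
  proof -
    have "(1 + \<tau>) *\<^sub>R m = \<tau> *\<^sub>R x + w" using \<tau> by (simp add: m_def scaleR_add_right)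
    then show ?thesis by (simp add: scaleR_diff_right) (simp add: algebra_simps)
  qed
  also have "norm \<dots> = norm ((w - z) - \<tau> *\<^sub>R (z - x))" by (rule norm_minus_cancel)
  finally have lo2: "(1 + \<tau>) * (d - \<eta>) \<le> norm ((w - z) - \<tau> *\<^sub>R (z - x))" .
  have "norm (\<tau> *\<^sub>R (z - x)) \<le> \<tau> * d" using \<tau> z xK dle by (auto intro!: mult_left_mono)
  also have "\<dots> \<le> (\<delta> / 2) * (2 * norm (w - z))"
    using \<tau> z \<eta> d by (intro mult_mono) (auto simp: norm_minus_commute)
  finally have "norm ((w - z) + \<tau> *\<^sub>R (z - x)) + norm ((w - z) - \<tau> *\<^sub>R (z - x))
      \<le> 2 * norm (w - z) + 1/2 * norm (\<tau> *\<^sub>R (z - x))" by (intro \<delta>(2)) simp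
  also have "\<dots> \<le> 2 * d + 1/2 * (\<tau> * d)"
    using \<tau> z xK w dle by (auto intro!: add_mono mult_left_mono)
  finally have "d - 2 * \<eta> + (1 + \<tau>) * (d - \<eta>) < 2 * d + 1/2 * (\<tau> * d)" using lo1 lo2 by linarith
  then have "\<tau> * d / 2 < \<eta> * (3 + \<tau>)" by (simp add: algebra_simps)
  also have "\<dots> \<le> \<eta> * 4" using \<tau> \<eta> by (intro mult_left_mono) auto
  finally show False using d \<tau> by (simp add: \<eta>_def)
qed

section \<open>Minimal invariant sets and Kirk's fixed point theorem\<close>

text \<open>Zorn's lemma: a chain of such sets is a directed family, so its intersection is nonempty
  and serves as a lower bound.\<close>

lemma uniformly_smooth_minimal_invariant:
  assumes us: "uniformly_smooth TYPE('a::banach)"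
    and K: "closed K" "convex K" "bounded (K :: 'a set)" "K \<noteq> {}" "T ` K \<subseteq> K"
  obtains M where "M \<subseteq> K" "closed M" "convex M" "M \<noteq> {}" "T ` M \<subseteq> M"
    "\<And>S. S \<subseteq> M \<Longrightarrow> closed S \<Longrightarrow> convex S \<Longrightarrow> S \<noteq> {} \<Longrightarrow> T ` S \<subseteq> S \<Longrightarrow> S = M"
proof -
  define \<S> where "\<S> = {S. S \<subseteq> K \<and> closed S \<and> convex S \<and> S \<noteq> {} \<and> T ` S \<subseteq> S}"
  \<comment> \<open>The order is reversed inclusion, so maximal elements are minimal sets.\<close>
  let ?P = "\<lambda>A B. B \<subseteq> (A :: 'a set)"
  have "\<exists>M\<in>\<S>. \<forall>A\<in>\<S>. ?P M A \<longrightarrow> A = M"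
  proof (rule predicate_Zorn)
    show "partial_order_on \<S> (relation_of ?P \<S>)"
      by (rule partial_order_on_relation_ofI) auto
  next
    fix \<C> assume \<C>: "\<C> \<in> Chains (relation_of ?P \<S>)"
    show "\<exists>U\<in>\<S>. \<forall>A\<in>\<C>. U \<subseteq> A"
    proof (cases "\<C> = {}")
      case True
      then show ?thesis using K by (auto simp: \<S>_def)
    next
      case False
      have sub: "\<C> \<subseteq> \<S>" and ch: "\<And>A B. A \<in> \<C> \<Longrightarrow> B \<in> \<C> \<Longrightarrow> A \<subseteq> B \<or> B \<subseteq> A"
        using \<C> unfolding Chains_def relation_of_def by auto
      have props: "A \<subseteq> K" "closed A" "convex A" "A \<noteq> {}" "T ` A \<subseteq> A" if "A \<in> \<C>" for A
        using sub that unfolding \<S>_def by auto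
      have "directed_convex \<C>"
        unfolding directed_convex_def
      proof (intro conjI ballI)
        fix A B assume "A \<in> \<C>" "B \<in> \<C>"
        with ch[of A B] show "\<exists>C\<in>\<C>. C \<subseteq> A \<inter> B" by blast
      qed (use False props bounded_subset[OF K(3)] in auto)
      from uniformly_smooth_directed_Inter[OF us this] have "\<Inter>\<C> \<noteq> {}" .
      moreover have "closed (\<Inter>\<C>)" "convex (\<Inter>\<C>)"
        using props by (auto intro: convex_Inter)
      moreover have "\<Inter>\<C> \<subseteq> K" using False props(1) by blast
      moreover have "T ` \<Inter>\<C> \<subseteq> \<Inter>\<C>"
      proof (intro image_subsetI InterI)
        fix z A assume "z \<in> \<Inter>\<C>" "A \<in> \<C>"
        with props(5)[of A] show "T z \<in> A" by blast
      qed
      ultimately have "\<Inter>\<C> \<in> \<S>" by (simp add: \<S>_def)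
      then show ?thesis by blast
    qed
  qed
  then obtain M where M: "M \<in> \<S>" "\<And>A. A \<in> \<S> \<Longrightarrow> A \<subseteq> M \<Longrightarrow> A = M" by blast
  have MK: "M \<subseteq> K" "closed M" "convex M" "M \<noteq> {}" "T ` M \<subseteq> M" using M(1) by (auto simp: \<S>_def)
  have "S = M" if "S \<subseteq> M" "closed S" "convex S" "S \<noteq> {}" "T ` S \<subseteq> S" for S
    using that MK(1) by (intro M(2)) (auto simp: \<S>_def)
  with MK that[of M] show thesis by blast
qed

text \<open>If a minimal invariant \<open>M\<close> had positive diameter, normal structure would
  give a centre in \<open>M\<close> with covering radius \<open>r\<close> below the diameter. The
  set of all such centres is closed, convex and invariant, hence all of \<open>M\<close>, so the
  diameter would be at most \<open>r\<close>. Thus \<open>M\<close> is a single, fixed,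
  point.\<close>

theorem uniformly_smooth_fixpoint:
  assumes us: "uniformly_smooth TYPE('a::banach)"
    and K: "closed K" "convex K" "bounded (K :: 'a set)" "K \<noteq> {}" "T ` K \<subseteq> K" "nonexpansive_on K T"
  obtains z where "z \<in> K" "T z = z"
proof -
  obtain M where M: "M \<subseteq> K" "closed M" "convex M" "M \<noteq> {}" "T ` M \<subseteq> M"
    and min: "\<And>S. S \<subseteq> M \<Longrightarrow> closed S \<Longrightarrow> convex S \<Longrightarrow> S \<noteq> {} \<Longrightarrow> T ` S \<subseteq> S \<Longrightarrow> S = M"
    using uniformly_smooth_minimal_invariant[OF us K(1-5)] by metis
  have bM: "bounded M" using M K bounded_subset by blast
  have "diameter M = 0"
  proof (rule ccontr)
    assume "diameter M \<noteq> 0"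
    then have "diameter M > 0" using diameter_ge_0[OF bM] by simp
    then obtain y r where yr: "y \<in> M" "r < diameter M" "M \<subseteq> cball y r"
      using uniformly_smooth_normal_structure[OF us M(2,3) bM] by blast
    have hull: "closure (convex hull (T ` M)) = M"
    proof (rule min)
      show sub: "closure (convex hull (T ` M)) \<subseteq> M"
        using M by (intro closure_minimal hull_minimal) auto
      have "T ` M \<subseteq> closure (convex hull (T ` M))"
        using closure_subset hull_subset by (metis order_trans)
      with sub show "T ` closure (convex hull (T ` M)) \<subseteq> closure (convex hull (T ` M))" by blast
    qed (use M in auto)
    let ?S = "{y\<in>M. M \<subseteq> cball y r}"
    have S: "?S = M \<inter> (\<Inter>k\<in>M. cball k r)" by (auto simp: dist_commute)
    have SM: "?S = M"
    proof (rule min)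
      show "closed ?S" "convex ?S" unfolding S using M
        by (auto intro!: convex_Int convex_INT)
      show "?S \<noteq> {}" using yr by auto
      show "T ` ?S \<subseteq> ?S"
      proof safe
        fix y assume y: "y \<in> M" "M \<subseteq> cball y r"
        then show "T y \<in> M" using M by auto
        have "T ` M \<subseteq> cball (T y) r"
        proof safe
          fix k assume "k \<in> M"
          then have "norm (T y - T k) \<le> norm (y - k)" "norm (y - k) \<le> r"
            using y K(6) M(1) unfolding nonexpansive_on_def by (auto simp: dist_norm)
          then show "T k \<in> cball (T y) r" by (simp add: dist_norm)
        qed
        then have "closure (convex hull (T ` M)) \<subseteq> cball (T y) r"
          by (intro closure_minimal hull_minimal) auto
        then show "k \<in> cball (T y) r" if "k \<in> M" for k using hull that by auto
      qed
    qed auto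
    have "norm (a - b) \<le> r" if "a \<in> M" "b \<in> M" for a b
    proof -
      have "b \<in> cball a r" using SM that by blast
      then show ?thesis by (simp add: dist_norm)
    qed
    then have "diameter M \<le> r" using M by (intro diameter_le) auto
    with yr show False by simp
  qed
  obtain z where z: "z \<in> M" using M by auto
  with M have "T z \<in> M" by auto
  from diameter_bounded_bound[OF bM this z] \<open>diameter M = 0\<close> have "T z = z" by simp
  with z M that show thesis by blast
qed

section \<open>Convergence of the implicit path\<close>

text \<open>A sublevel set of the function sending \<open>y\<close> to the limsup of
  \<open>norm (f i - y)\<close> along \<open>F\<close>; the slack \<open>e\<close> expresses the
  limsup by eventual bounds.\<close>

definition asymptotic_ball :: "'i filter \<Rightarrow> ('i \<Rightarrow> 'a::real_normed_vector) \<Rightarrow> real \<Rightarrow> 'a set" where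
  "asymptotic_ball F f r = {y. \<forall>e>0. \<forall>\<^sub>F i in F. norm (f i - y) \<le> r + e}"

lemma closed_asymptotic_ball: "closed (asymptotic_ball F f r)"
  unfolding closed_sequential_limits
proof (intro allI impI)
  fix ys y assume ys: "(\<forall>n. ys n \<in> asymptotic_ball F f r) \<and> ys \<longlonglongrightarrow> y"
  show "y \<in> asymptotic_ball F f r"
    unfolding asymptotic_ball_def
  proof (intro CollectI allI impI)
    fix e :: real assume "e > 0"
    then have "\<forall>\<^sub>F n in sequentially. dist (ys n) y < e / 2" using ys by (intro tendstoD) auto
    then obtain n where n: "dist (ys n) y < e / 2" by (auto dest: eventually_happens)
    have "\<forall>\<^sub>F i in F. norm (f i - ys n) \<le> r + e / 2"
      using ys \<open>e > 0\<close> unfolding asymptotic_ball_def by auto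
    then show "\<forall>\<^sub>F i in F. norm (f i - y) \<le> r + e"
    proof (rule eventually_mono)
      fix i assume "norm (f i - ys n) \<le> r + e / 2"
      with n norm_triangle_ineq[of "f i - ys n" "ys n - y"] show "norm (f i - y) \<le> r + e"
        by (simp add: dist_norm)
    qed
  qed
qed

lemma convex_asymptotic_ball: "convex (asymptotic_ball F f r)"
proof (rule convexI)
  fix x y u v assume *: "x \<in> asymptotic_ball F f r" "y \<in> asymptotic_ball F f r" "0 \<le> u" "0 \<le> v" "u + v = (1::real)"
  show "u *\<^sub>R x + v *\<^sub>R y \<in> asymptotic_ball F f r"
    unfolding asymptotic_ball_def
  proof (intro CollectI allI impI)
    fix e :: real assume "e > 0"
    with * have "\<forall>\<^sub>F i in F. norm (f i - x) \<le> r + e" "\<forall>\<^sub>F i in F. norm (f i - y) \<le> r + e"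
      unfolding asymptotic_ball_def by auto
    then show "\<forall>\<^sub>F i in F. norm (f i - (u *\<^sub>R x + v *\<^sub>R y)) \<le> r + e"
    proof eventually_elim
      case (elim i)
      then have "x \<in> cball (f i) (r + e)" "y \<in> cball (f i) (r + e)" by (auto simp: dist_norm)
      then have "u *\<^sub>R x + v *\<^sub>R y \<in> cball (f i) (r + e)"
        using * by (intro convexD[OF convex_cball]) auto
      then show ?case by (simp add: dist_norm)
    qed
  qed
qed

text \<open>Along \<open>F\<close> the points \<open>f i\<close> and \<open>T (f i)\<close> merge,
  so nonexpansiveness keeps the limsup distance from growing when \<open>y\<close> is replaced by
  \<open>T y\<close>.\<close>

lemma asymptotic_ball_invariant:
  assumes "nonexpansive_on D T" "\<forall>\<^sub>F i in F. f i \<in> D" "((\<lambda>i. T (f i) - f i) \<longlongrightarrow> 0) F"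
    and y: "y \<in> D" "y \<in> asymptotic_ball F f r"
  shows "T y \<in> asymptotic_ball F f r"
  unfolding asymptotic_ball_def
proof (intro CollectI allI impI)
  fix e :: real assume "e > 0"
  then have "\<forall>\<^sub>F i in F. norm (T (f i) - f i) < e / 2" using tendstoD[OF assms(3), of "e / 2"] by simp
  moreover have "\<forall>\<^sub>F i in F. norm (f i - y) \<le> r + e / 2"
    using y \<open>e > 0\<close> unfolding asymptotic_ball_def by auto
  ultimately show "\<forall>\<^sub>F i in F. norm (f i - T y) \<le> r + e"
    using assms(2)
  proof eventually_elim
    case (elim i)
    have "norm (T (f i) - T y) \<le> norm (f i - y)"
      using assms(1) elim y unfolding nonexpansive_on_def by auto
    with elim norm_triangle_ineq[of "f i - T (f i)" "T (f i) - T y"] show ?case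
      by (simp add: norm_minus_commute)
  qed
qed

text \<open>The least radius is attained: the sets for larger radii form a directed family, and a
  common point lies in the set for the infimum itself.\<close>

lemma uniformly_smooth_asymptotic_center:
  assumes us: "uniformly_smooth TYPE('a::banach)"
    and D: "closed D" "convex (D :: 'a set)" "p \<in> D"
    and F: "F \<noteq> bot" and bdd: "\<forall>\<^sub>F i in F. norm (f i - p) \<le> B"
  obtains r where "r \<ge> 0" "D \<inter> asymptotic_ball F f r \<noteq> {}" "bounded (D \<inter> asymptotic_ball F f r)"
    "\<And>s. s < r \<Longrightarrow> D \<inter> asymptotic_ball F f s = {}"
proof -
  let ?A = "\<lambda>r. D \<inter> asymptotic_ball F f r"
  have mono: "?A r \<subseteq> ?A s" if "r \<le> s" for r s
  proof -
    have "\<forall>\<^sub>F i in F. norm (f i - y) \<le> s + e" if "\<forall>\<^sub>F i in F. norm (f i - y) \<le> r + e" for y e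
      using that by (rule eventually_mono) (use \<open>r \<le> s\<close> in auto)
    then show ?thesis unfolding asymptotic_ball_def by blast
  qed
  have bounded: "bounded (?A r)" for r
    unfolding bounded_iff
  proof (intro exI ballI)
    fix y assume "y \<in> ?A r"
    then have "\<forall>\<^sub>F i in F. norm (f i - y) \<le> r + 1" by (auto simp: asymptotic_ball_def)
    with bdd have "\<forall>\<^sub>F i in F. norm y \<le> norm p + B + (r + 1)"
    proof eventually_elim
      case (elim i)
      with norm_triangle_ineq4[of "p + (f i - p)" "f i - y"] norm_triangle_ineq[of p "f i - p"]
      show ?case by simp
    qed
    then show "norm y \<le> norm p + B + (r + 1)" using F by (auto dest: eventually_happens)
  qed
  define R where "R = {r. ?A r \<noteq> {}}"
  have nonneg: "0 \<le> r" if "r \<in> R" for r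
  proof (rule ccontr)
    assume "\<not> 0 \<le> r"
    then have "0 < - r / 2" by simp
    with that obtain y where "\<forall>\<^sub>F i in F. norm (f i - y) \<le> r + - r / 2"
      unfolding R_def asymptotic_ball_def by blast
    then obtain i where "norm (f i - y) \<le> r + - r / 2" using F by (auto dest: eventually_happens)
    with \<open>\<not> 0 \<le> r\<close> norm_ge_zero[of "f i - y"] show False by linarith
  qed
  then have bdd_below: "bdd_below R" by (rule bdd_belowI)
  have "p \<in> ?A B" unfolding asymptotic_ball_def
    using D bdd by (auto elim!: eventually_mono)
  then have Rne: "R \<noteq> {}" unfolding R_def by blast
  define \<C> where "\<C> = ?A ` {Inf R <..}"
  have above: "?A s \<noteq> {}" if s: "Inf R < s" for s
  proof -
    obtain r where "r \<in> R" "r < s" using cInf_lessD[OF Rne s] by blast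
    with mono[of r s] show ?thesis unfolding R_def by auto
  qed
  have "directed_convex \<C>"
    unfolding directed_convex_def
  proof (intro conjI ballI)
    show "\<C> \<noteq> {}" by (auto simp: \<C>_def gt_ex)
  next
    fix C assume "C \<in> \<C>"
    then obtain s where s: "Inf R < s" "C = ?A s" by (auto simp: \<C>_def)
    show "C \<noteq> {}" using above s by simp
    show "closed C" unfolding s using D(1) closed_asymptotic_ball by (rule closed_Int)
    show "convex C" unfolding s using D(2) convex_asymptotic_ball by (rule convex_Int)
    show "bounded C" unfolding s by (rule bounded)
  next
    fix A B assume "A \<in> \<C>" "B \<in> \<C>"
    then obtain s t where s: "Inf R < s" "A = ?A s" and t: "Inf R < t" "B = ?A t"
      by (auto simp: \<C>_def)
    have "?A (min s t) \<subseteq> A \<inter> B" using mono[of "min s t" s] mono[of "min s t" t] s t by auto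
    moreover have "?A (min s t) \<in> \<C>" unfolding \<C>_def using s t by (intro imageI) auto
    ultimately show "\<exists>C\<in>\<C>. C \<subseteq> A \<inter> B" by blast
  qed
  from uniformly_smooth_directed_Inter[OF us this] obtain y where y: "\<And>s. Inf R < s \<Longrightarrow> y \<in> ?A s"
    by (auto simp: \<C>_def)
  have "y \<in> D" using y[of "Inf R + 1"] by simp
  moreover have "y \<in> asymptotic_ball F f (Inf R)"
    unfolding asymptotic_ball_def
  proof (intro CollectI allI impI)
    fix e :: real assume e: "e > 0"
    with y[of "Inf R + e / 2"] have "\<forall>\<^sub>F i in F. norm (f i - y) \<le> Inf R + e / 2 + e / 2"
      unfolding asymptotic_ball_def by (auto dest!: spec[of _ "e / 2"])
    then show "\<forall>\<^sub>F i in F. norm (f i - y) \<le> Inf R + e" by (rule eventually_mono) linarith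
  qed
  ultimately have "?A (Inf R) \<noteq> {}" by blast
  moreover have "?A s = {}" if "s < Inf R" for s
  proof (rule ccontr)
    assume "?A s \<noteq> {}"
    then have "Inf R \<le> s" using bdd_below by (intro cInf_lower) (auto simp: R_def)
    with that show False by simp
  qed
  moreover have "Inf R \<ge> 0" using Rne nonneg by (rule cInf_greatest)
  ultimately show thesis using that bounded by blast
qed

section \<open>The implicit path and its limit\<close>

text \<open>Metric form of the accretivity of the identity minus T at an approximate fixed point z.\<close>
lemma implicit_point_accretive:
  fixes x z :: "'a::real_normed_vector"
  assumes x: "x = t *\<^sub>R u + (1 - t) *\<^sub>R T x" and t: "0 < t" "t \<le> 1"
    and T: "norm (T x - T z) \<le> norm (x - z)" and "\<kappa> \<ge> 0"
  shows "norm (x - z) - \<kappa> * ((1 - t) / t) * norm (T z - z) \<le> norm ((x - z) + \<kappa> *\<^sub>R (u - x))"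
proof -
  \<comment> \<open>By the implicit equation \<open>u - x\<close> is \<open>(1 - t) / t\<close>
    times \<open>x - T x\<close>, so \<kappa>' is the factor of the same displacement along
    \<open>x - T x\<close>.\<close>
  define \<kappa>' where "\<kappa>' = \<kappa> * ((1 - t) / t)"
  have \<kappa>': "\<kappa>' \<ge> 0" using assms by (simp add: \<kappa>'_def)
  have "t *\<^sub>R (u - x) = (1 - t) *\<^sub>R (x - T x)"
  proof -
    have "t *\<^sub>R u = x - (1 - t) *\<^sub>R T x" by (subst (1) x) simp
    then show ?thesis by (simp add: algebra_simps)
  qed
  then have "(1 / t) *\<^sub>R t *\<^sub>R (u - x) = (1 / t) *\<^sub>R (1 - t) *\<^sub>R (x - T x)" by (rule arg_cong)
  then have "u - x = ((1 - t) / t) *\<^sub>R (x - T x)" using t by simp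
  then have "\<kappa> *\<^sub>R (u - x) = \<kappa>' *\<^sub>R (x - T x)" by (simp add: \<kappa>'_def)
  then have eq: "(x - z) + \<kappa> *\<^sub>R (u - x) = (1 + \<kappa>') *\<^sub>R (x - z) - \<kappa>' *\<^sub>R (T x - z)"
    by (simp add: algebra_simps)
  have "norm (T x - z) \<le> norm (x - z) + norm (T z - z)"
    using T norm_triangle_ineq[of "T x - T z" "T z - z"] by simp
  then have "\<kappa>' * norm (T x - z) \<le> \<kappa>' * (norm (x - z) + norm (T z - z))"
    using \<kappa>' by (rule mult_left_mono)
  moreover have "norm ((1 + \<kappa>') *\<^sub>R (x - z)) - norm (\<kappa>' *\<^sub>R (T x - z)) \<le> norm ((x - z) + \<kappa> *\<^sub>R (u - x))"
    unfolding eq by (rule norm_triangle_ineq2)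
  moreover have "norm ((1 + \<kappa>') *\<^sub>R (x - z)) = norm (x - z) + \<kappa>' * norm (x - z)"
    "norm (\<kappa>' *\<^sub>R (T x - z)) = \<kappa>' * norm (T x - z)"
    using \<kappa>' by (simp_all only: norm_scaleR) (auto simp: algebra_simps)
  ultimately show ?thesis unfolding \<kappa>'_def[symmetric] by (simp only: distrib_left)
qed

text \<open>\<open>x - p\<close> mixes \<open>u - p\<close> and \<open>T x - p\<close>; absorbing
  the latter on the left leaves \<open>t\<close> times the claim.\<close>

lemma implicit_point_bounded:
  fixes x p :: "'a::real_normed_vector"
  assumes "x = t *\<^sub>R u + (1 - t) *\<^sub>R T x" "0 < t" "t \<le> 1" "norm (T x - p) \<le> norm (x - p)"
  shows "norm (x - p) \<le> norm (u - p)"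
proof -
  have "x - p = t *\<^sub>R (u - p) + (1 - t) *\<^sub>R (T x - p)"
    by (subst (1) assms(1)) (simp add: algebra_simps)
  then have "norm (x - p) \<le> t * norm (u - p) + (1 - t) * norm (T x - p)"
    using norm_triangle_ineq[of "t *\<^sub>R (u - p)" "(1 - t) *\<^sub>R (T x - p)"] assms by simp
  also have "\<dots> \<le> t * norm (u - p) + (1 - t) * norm (x - p)"
    using assms by (intro add_left_mono mult_left_mono) auto
  finally have "t * norm (x - p) \<le> t * norm (u - p)" by (simp add: algebra_simps)
  then show ?thesis using assms by simp
qed

text \<open>The asymptotic centre of the path is invariant under \<open>T\<close> and so contains a
  fixed point \<open>q\<close>. For \<open>b = X t - q\<close> and \<open>w = u - q\<close> the
  implicit equation gives \<open>(1 + \<mu>) * norm b \<le> norm (b + \<mu> *\<^sub>R w)\<close>. If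
  the least radius \<open>r\<close> were positive, smoothness would make
  \<open>q + \<mu> *\<^sub>R w\<close> a better centre than \<open>q\<close>.\<close>

theorem uniformly_smooth_implicit_path_converges:
  fixes D :: "'a::banach set"
  assumes us: "uniformly_smooth TYPE('a)"
    and D: "closed D" "convex D" "T ` D \<subseteq> D" "nonexpansive_on D T" "fixpoints D T \<noteq> {}" "u \<in> D"
    and X: "\<And>t. 0 < t \<Longrightarrow> t < 1 \<Longrightarrow> X t \<in> D"
      "\<And>t. 0 < t \<Longrightarrow> t < 1 \<Longrightarrow> X t = t *\<^sub>R u + (1 - t) *\<^sub>R T (X t)"
  obtains q where "q \<in> fixpoints D T" "(X \<longlongrightarrow> q) (at_right 0)"
proof -
  let ?F = "at_right (0::real)"
  have ev: "\<forall>\<^sub>F t in ?F. 0 < t \<and> t < 1"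
    using eventually_at_right_real[of 0 1] by simp
  have T: "norm (T a - T b) \<le> norm (a - b)" if "a \<in> D" "b \<in> D" for a b
    using D that by (auto simp: nonexpansive_on_def)
  obtain p where p: "p \<in> D" "T p = p" using D by (auto simp: fixpoints_def)
  have bdd: "norm (X t - p) \<le> norm (u - p)" if "0 < t" "t < 1" for t
    using X[OF that] that T[of "X t" p] p by (intro implicit_point_bounded[of _ t u T]) auto
  have afp: "((\<lambda>t. T (X t) - X t) \<longlongrightarrow> 0) ?F"
  proof (rule Lim_null_comparison)
    show "\<forall>\<^sub>F t in ?F. norm (T (X t) - X t) \<le> t * (2 * norm (u - p))"
      using ev
    proof eventually_elim
      case (elim t)
      have "T (X t) - X t = t *\<^sub>R (T (X t) - u)"
        using X(2)[of t] elim by (subst (2) X(2)) (auto simp: algebra_simps)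
      then have "norm (T (X t) - X t) = t * norm (T (X t) - u)" using elim by simp
      also have "norm (T (X t) - u) \<le> 2 * norm (u - p)"
        using T[of "X t" p] p X(1)[of t] elim bdd[of t] norm_triangle_ineq4[of "T (X t) - p" "u - p"]
        by simp
      finally show ?case using elim by simp
    qed
    show "((\<lambda>t. t * (2 * norm (u - p))) \<longlongrightarrow> 0) ?F"
      by (auto intro!: tendsto_eq_intros)
  qed
  have inD: "\<forall>\<^sub>F t in ?F. X t \<in> D" using ev by eventually_elim (use X in auto)
  have bddF: "\<forall>\<^sub>F t in ?F. norm (X t - p) \<le> norm (u - p)"
    using ev by eventually_elim (use bdd in auto)
  obtain r where r: "r \<ge> 0" "D \<inter> asymptotic_ball ?F X r \<noteq> {}" "bounded (D \<inter> asymptotic_ball ?F X r)"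
    "\<And>s. s < r \<Longrightarrow> D \<inter> asymptotic_ball ?F X s = {}"
    using uniformly_smooth_asymptotic_center[OF us D(1,2) p(1) trivial_limit_at_right_real bddF] by blast
  obtain q where q: "q \<in> D \<inter> asymptotic_ball ?F X r" "T q = q"
  proof (rule uniformly_smooth_fixpoint[OF us _ _ r(3,2), of T])
    show "closed (D \<inter> asymptotic_ball ?F X r)" using D(1) closed_asymptotic_ball by (rule closed_Int)
    show "convex (D \<inter> asymptotic_ball ?F X r)" using D(2) convex_asymptotic_ball by (rule convex_Int)
    show "T ` (D \<inter> asymptotic_ball ?F X r) \<subseteq> D \<inter> asymptotic_ball ?F X r"
      using D asymptotic_ball_invariant[OF D(4) inD afp] by auto
    show "nonexpansive_on (D \<inter> asymptotic_ball ?F X r) T"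
      using D by (auto simp: nonexpansive_on_def)
  qed
  have "r = 0"
  proof (rule ccontr)
    assume "r \<noteq> 0"
    with r have rpos: "r > 0" by simp
    define w where "w = u - q"
    \<comment> \<open>The added 1 keeps \<open>N\<close> positive when \<open>u = q\<close>.\<close>
    define N where "N = norm w + 1"
    have N: "norm w \<le> N" "N > 0" unfolding N_def by (auto simp: add_nonneg_pos)
    obtain \<delta> where \<delta>: "\<delta> > 0"
      "\<And>(b::'a) y. norm y \<le> \<delta> * norm b \<Longrightarrow> norm (b + y) + norm (b - y) \<le> 2 * norm b + r / (4 * N) * norm y"
      using uniformly_smooth_scaled[OF us, of "r / (4 * N)"] rpos N by auto
    \<comment> \<open>The bound \<open>1/2\<close> keeps the moved centre on the segment from
      \<open>q\<close> to \<open>u\<close>, the second gives \<open>r / 2 \<le> norm b\<close>, and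
      the third then meets the smallness condition of smoothness.\<close>
    define \<mu> where "\<mu> = min (1/2) (min (r / (4 * N)) (\<delta> * r / (2 * N)))"
    have \<mu>: "0 < \<mu>" "\<mu> \<le> 1 / 2" "\<mu> \<le> r / (4 * N)" "\<mu> \<le> \<delta> * r / (2 * N)"
      using \<delta> rpos N by (auto simp: \<mu>_def)
    have "\<mu> * norm w \<le> \<mu> * N" using \<mu> N by (intro mult_left_mono) auto
    moreover have "\<mu> * N \<le> r / 4" "\<mu> * N \<le> \<delta> * r / 2"
      using \<mu> N by (auto simp: field_simps)
    ultimately have \<mu>w: "\<mu> * norm w \<le> r / 4" "\<mu> * norm w \<le> \<delta> * r / 2" by linarith+
    \<comment> \<open>The closing inequality would need \<open>2 * \<eta>\<close> to exceed
      \<open>3 * (\<mu> * r) / 4\<close>; here it is only \<open>\<mu> * r / 4\<close>.\<close>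
    define \<eta> where "\<eta> = \<mu> * r / 8"
    have \<eta>: "\<eta> > 0" "\<eta> \<le> r / 16" using \<mu> rpos by (auto simp: \<eta>_def)
    have up: "\<forall>\<^sub>F t in ?F. norm (X t - q) \<le> r + \<eta>"
      using q \<eta> by (auto simp: asymptotic_ball_def)
    have "q + \<mu> *\<^sub>R w \<in> D"
    proof -
      have "q + \<mu> *\<^sub>R w = (1 - \<mu>) *\<^sub>R q + \<mu> *\<^sub>R u" by (simp add: w_def algebra_simps)
      also have "\<dots> \<in> D" using q D \<mu> by (intro convexD) auto
      finally show ?thesis .
    qed
    then have "q + \<mu> *\<^sub>R w \<notin> asymptotic_ball ?F X (r - \<eta>)" using r(4)[of "r - \<eta>"] \<eta> by auto
    then obtain e where e: "e > 0" "\<not> (\<forall>\<^sub>F t in ?F. norm (X t - (q + \<mu> *\<^sub>R w)) \<le> (r - \<eta>) + e)"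
      by (auto simp: asymptotic_ball_def)
    have "\<exists>t. 0 < t \<and> t < 1 \<and> norm (X t - q) \<le> r + \<eta> \<and> r - \<eta> < norm (X t - (q + \<mu> *\<^sub>R w))"
    proof (rule ccontr)
      assume neg: "\<not> ?thesis"
      from ev up have "\<forall>\<^sub>F t in ?F. norm (X t - (q + \<mu> *\<^sub>R w)) \<le> (r - \<eta>) + e"
      proof eventually_elim
        case (elim t)
        with neg have "\<not> r - \<eta> < norm (X t - (q + \<mu> *\<^sub>R w))" by blast
        with e show ?case by linarith
      qed
      with e show False by blast
    qed
    then obtain t where t: "0 < t" "t < 1" "norm (X t - q) \<le> r + \<eta>" "r - \<eta> < norm (X t - (q + \<mu> *\<^sub>R w))"
      by blast
    define b where "b = X t - q"
    have b: "norm b \<le> r + \<eta>" "r - \<eta> < norm (b - \<mu> *\<^sub>R w)" using t by (auto simp: b_def algebra_simps)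
    have "norm (b - \<mu> *\<^sub>R w) \<le> norm b + \<mu> * norm w"
      using norm_triangle_ineq4[of b "\<mu> *\<^sub>R w"] \<mu> by simp
    with b \<eta> \<mu>w have "r / 2 \<le> norm b" by linarith
    then have "\<delta> * (r / 2) \<le> \<delta> * norm b" using \<delta> by (intro mult_left_mono) auto
    with \<mu>w \<mu> have "norm (\<mu> *\<^sub>R w) \<le> \<delta> * norm b" by simp
    then have sm: "norm (b + \<mu> *\<^sub>R w) + norm (b - \<mu> *\<^sub>R w) \<le> 2 * norm b + r / (4 * N) * norm (\<mu> *\<^sub>R w)"
      by (rule \<delta>(2))
    have "r / (4 * N) * norm (\<mu> *\<^sub>R w) \<le> r / (4 * N) * (\<mu> * N)"
      using \<mu> N rpos by (intro mult_left_mono) auto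
    also have "\<dots> = \<mu> * r / 4" using N by simp
    finally have small: "r / (4 * N) * norm (\<mu> *\<^sub>R w) \<le> \<mu> * r / 4" .
    \<comment> \<open>The weight \<open>\<mu> / (1 + \<mu>)\<close> is chosen because, after
      multiplying by \<open>1 + \<mu>\<close>, the extra \<open>\<mu> *\<^sub>R b\<close> completes
      \<open>u - X t\<close> to \<open>u - q\<close>.\<close>
    have "norm b \<le> norm (b + (\<mu> / (1 + \<mu>)) *\<^sub>R (u - X t))"
      using implicit_point_accretive[of "X t" t u T q "\<mu> / (1 + \<mu>)"] X(1,2)[of t] T[of "X t" q] t q \<mu>
      unfolding b_def by auto
    then have "(1 + \<mu>) * norm b \<le> (1 + \<mu>) * norm (b + (\<mu> / (1 + \<mu>)) *\<^sub>R (u - X t))"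
      using \<mu> by (intro mult_left_mono) auto
    also have "\<dots> = norm ((1 + \<mu>) *\<^sub>R (b + (\<mu> / (1 + \<mu>)) *\<^sub>R (u - X t)))" using \<mu> by simp
    also have "(1 + \<mu>) *\<^sub>R (b + (\<mu> / (1 + \<mu>)) *\<^sub>R (u - X t)) = (1 + \<mu>) *\<^sub>R b + \<mu> *\<^sub>R (u - X t)"
      using \<mu> by (simp add: scaleR_add_right)
    also have "\<dots> = b + \<mu> *\<^sub>R w" by (simp add: b_def w_def algebra_simps)
    finally have lo: "(1 + \<mu>) * norm b \<le> norm (b + \<mu> *\<^sub>R w)" .
    have "r - \<eta> \<le> (1 - \<mu>) * norm b + \<mu> * r / 4"
    proof -
      have "(1 + \<mu>) * norm b = norm b + \<mu> * norm b" "(1 - \<mu>) * norm b = norm b - \<mu> * norm b"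
        by (auto simp: algebra_simps)
      with sm small lo b show ?thesis by linarith
    qed
    also have "(1 - \<mu>) * norm b \<le> (1 - \<mu>) * (r + \<eta>)" using b \<mu> by (intro mult_left_mono) auto
    finally have "3 * (\<mu> * r) / 4 \<le> 2 * \<eta> - \<mu> * \<eta>" by (simp add: algebra_simps)
    moreover have "\<mu> * \<eta> > 0" "\<mu> * r > 0" using \<mu> \<eta> rpos by auto
    ultimately show False unfolding \<eta>_def by simp
  qed
  have "(X \<longlongrightarrow> q) ?F"
  proof (rule tendstoI)
    fix e :: real assume "e > 0"
    then have "\<forall>\<^sub>F t in ?F. norm (X t - q) \<le> 0 + e / 2"
      using q \<open>r = 0\<close> unfolding asymptotic_ball_def by (auto dest!: spec[of _ "e / 2"])
    then show "\<forall>\<^sub>F t in ?F. dist (X t) q < e"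
      by eventually_elim (use \<open>e > 0\<close> in \<open>simp add: dist_norm\<close>)
  qed
  moreover have "q \<in> fixpoints D T" using q by (simp add: fixpoints_def)
  ultimately show thesis using that by blast
qed

section \<open>The iteration\<close>

text \<open>Subtracting the partial sums of the errors leaves an eventually decreasing sequence
  bounded below, so \<open>a\<close> converges. A positive limit would dominate a multiple of
  \<alpha> by summable telescoping terms.\<close>

lemma summable_perturbed_contraction:
  fixes a \<alpha> e :: "nat \<Rightarrow> real"
  assumes a: "\<And>n. 0 \<le> a n" and \<alpha>: "\<And>n. 0 \<le> \<alpha> n" "\<not> summable \<alpha>" and e: "\<And>n. 0 \<le> e n" "summable e"
    and rec: "\<forall>\<^sub>F n in sequentially. a (Suc n) \<le> (1 - \<alpha> n) * a n + e n"
  shows "a \<longlonglongrightarrow> 0"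
proof -
  obtain N where N: "\<And>n. n \<ge> N \<Longrightarrow> a (Suc n) \<le> (1 - \<alpha> n) * a n + e n"
    using rec by (auto simp: eventually_sequentially)
  define A E where "A n = a (n + N)" and "E n = e (n + N)" for n
  have sumE: "summable E" unfolding E_def using e by (subst summable_iff_shift)
  have step: "A (Suc n) \<le> A n - \<alpha> (n + N) * A n + E n" for n
    using N[of "n + N"] by (simp add: A_def E_def algebra_simps)
  define b where "b n = A n - (\<Sum>k<n. E k)" for n
  have "decseq b"
  proof (rule decseq_SucI)
    fix n
    have "0 \<le> \<alpha> (n + N) * A n" using a \<alpha> by (simp add: A_def)
    with step[of n] show "b (Suc n) \<le> b n" by (simp add: b_def)
  qed
  moreover have "- suminf E \<le> b n" for n
  proof -
    have "(\<Sum>k<n. E k) \<le> suminf E" using sumE e by (intro sum_le_suminf) (auto simp: E_def)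
    moreover have "0 \<le> A n" using a by (simp add: A_def)
    ultimately show ?thesis by (simp add: b_def)
  qed
  ultimately obtain l where "b \<longlonglongrightarrow> l" using decseq_convergent by blast
  from tendsto_add[OF this summable_LIMSEQ[OF sumE]] have A: "A \<longlonglongrightarrow> l + suminf E"
    by (simp add: b_def)
  define L where "L = l + suminf E"
  have AL: "A \<longlonglongrightarrow> L" using A by (simp add: L_def)
  have "L \<ge> 0" by (rule LIMSEQ_le_const[OF AL]) (auto simp: A_def a)
  have "L = 0"
  proof (rule ccontr)
    assume "L \<noteq> 0"
    with \<open>L \<ge> 0\<close> have L: "L > 0" by simp
    then have "\<forall>\<^sub>F n in sequentially. L / 2 < A n" using AL by (intro order_tendstoD(1)[OF AL]) auto
    then obtain M where M: "\<And>n. n \<ge> M \<Longrightarrow> L / 2 < A n" by (auto simp: eventually_sequentially)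
    have "summable (\<lambda>n. A n - A (Suc n) + E n)"
      by (intro summable_add sumE telescope_summable'[OF AL])
    moreover have "norm (L / 2 * \<alpha> (n + N)) \<le> A n - A (Suc n) + E n" if "n \<ge> M" for n
    proof -
      have "L / 2 * \<alpha> (n + N) \<le> A n * \<alpha> (n + N)" using M[OF that] \<alpha> by (intro mult_right_mono) auto
      with step[of n] \<alpha> L show ?thesis by (simp add: algebra_simps)
    qed
    ultimately have "summable (\<lambda>n. L / 2 * \<alpha> (n + N))" by (rule summable_comparison_test')
    then have "summable (\<lambda>n. \<alpha> (n + N))" using L by (subst (asm) summable_cmult_iff) auto
    then have "summable \<alpha>" by (subst (asm) summable_iff_shift)
    with \<alpha> show False by blast
  qed
  with AL have "(\<lambda>n. a (n + N)) \<longlonglongrightarrow> 0" by (simp add: A_def[abs_def])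
  then show ?thesis by (rule LIMSEQ_offset)
qed

text \<open>\<open>c\<close> is fixed by the map sending \<open>r\<close> to
  \<open>(1 - \<alpha> n) * r + \<alpha> n * c\<close>, so the excess of \<open>s\<close> over
  \<open>c\<close> obeys the recursion without tolerance; the other alternative makes the excess
  0.\<close>

lemma perturbed_contraction_up_to_tolerance:
  fixes s \<alpha> e :: "nat \<Rightarrow> real"
  assumes s: "\<And>n. 0 \<le> s n" and \<alpha>: "\<And>n. 0 \<le> \<alpha> n" "\<And>n. \<alpha> n \<le> 1" "\<not> summable \<alpha>"
    and e: "\<And>n. 0 \<le> e n" "summable e"
    and rec: "\<And>c. c > 0 \<Longrightarrow> \<forall>\<^sub>F n in sequentially. s (Suc n) \<le> max c ((1 - \<alpha> n) * s n + \<alpha> n * c + e n)"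
  shows "s \<longlonglongrightarrow> 0"
proof (rule tendstoI)
  fix d :: real assume "d > 0"
  define c where "c = d / 2"
  have c: "c > 0" using \<open>d > 0\<close> by (simp add: c_def)
  have "(\<lambda>n. max 0 (s n - c)) \<longlonglongrightarrow> 0"
  proof (rule summable_perturbed_contraction[OF _ \<alpha>(1,3) e])
    show "\<forall>\<^sub>F n in sequentially. max 0 (s (Suc n) - c) \<le> (1 - \<alpha> n) * max 0 (s n - c) + e n"
      using rec[OF c]
    proof eventually_elim
      case (elim n)
      have "0 \<le> (1 - \<alpha> n) * max 0 (s n - c)" using \<alpha> by (intro mult_nonneg_nonneg) auto
      moreover have "(1 - \<alpha> n) * (s n - c) \<le> (1 - \<alpha> n) * max 0 (s n - c)"
        using \<alpha> by (intro mult_left_mono) auto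
      moreover have "(1 - \<alpha> n) * (s n - c) = (1 - \<alpha> n) * s n + \<alpha> n * c - c" by (simp add: algebra_simps)
      ultimately show ?case using elim e(1)[of n] by linarith
    qed
  qed simp
  then have "\<forall>\<^sub>F n in sequentially. max 0 (s n - c) < c" using c by (rule order_tendstoD(2))
  then show "\<forall>\<^sub>F n in sequentially. dist (s n) 0 < d"
  proof eventually_elim
    case (elim n)
    then have "s n < d" unfolding c_def by linarith
    with s[of n] show ?case by (simp add: dist_real_def)
  qed
qed

section \<open>The implicit points and the map Q at a constant\<close>

lemma implicit_point_exists:
  fixes D :: "'a::banach set"
  assumes D: "closed D" "convex D" "T ` D \<subseteq> D" "nonexpansive_on D T" "u \<in> D" and t: "0 < t" "t < 1"
  shows "implicit_point D T (\<lambda>_. u) t \<in> D"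
    "implicit_point D T (\<lambda>_. u) t = t *\<^sub>R u + (1 - t) *\<^sub>R T (implicit_point D T (\<lambda>_. u) t)"
proof -
  let ?f = "\<lambda>x. t *\<^sub>R u + (1 - t) *\<^sub>R T x"
  have "\<exists>!x\<in>D. ?f x = x"
  proof (rule Banach_fix[where c = "1 - t"])
    show "complete D" using D by (simp add: complete_eq_closed)
    show "D \<noteq> {}" using D by auto
    show "?f ` D \<subseteq> D"
    proof (intro image_subsetI)
      fix x assume "x \<in> D"
      then show "?f x \<in> D" using D t by (intro convexD) auto
    qed
    show "dist (?f x) (?f y) \<le> (1 - t) * dist x y" if "x \<in> D" "y \<in> D" for x y
    proof -
      have "?f x - ?f y = (1 - t) *\<^sub>R (T x - T y)" by (simp add: algebra_simps)
      then have "dist (?f x) (?f y) = (1 - t) * norm (T x - T y)" using t by (simp only: dist_norm) simp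
      also have "\<dots> \<le> (1 - t) * dist x y"
        using D(4) that t by (intro mult_left_mono) (auto simp: nonexpansive_on_def dist_norm)
      finally show ?thesis .
    qed
  qed (use t in auto)
  then have "\<exists>!x. x \<in> D \<and> x = ?f x" by metis
  from theI'[OF this] show "implicit_point D T (\<lambda>_. u) t \<in> D"
    "implicit_point D T (\<lambda>_. u) t = t *\<^sub>R u + (1 - t) *\<^sub>R T (implicit_point D T (\<lambda>_. u) t)"
    unfolding implicit_point_def by blast+
qed

text \<open>\<open>Lim\<close> in \<open>Qmap\<close> becomes usable once convergence of the path is
  known.\<close>

theorem uniformly_smooth_Qmap:
  fixes D :: "'a::banach set"
  assumes us: "uniformly_smooth TYPE('a)"
    and D: "closed D" "convex D" "T ` D \<subseteq> D" "nonexpansive_on D T" "fixpoints D T \<noteq> {}" "u \<in> D"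
  shows "Qmap D T (\<lambda>_. u) \<in> fixpoints D T"
    "(implicit_point D T (\<lambda>_. u) \<longlongrightarrow> Qmap D T (\<lambda>_. u)) (at_right 0)"
proof -
  obtain q where q: "q \<in> fixpoints D T" "(implicit_point D T (\<lambda>_. u) \<longlongrightarrow> q) (at_right 0)"
    using uniformly_smooth_implicit_path_converges[OF us D, of "implicit_point D T (\<lambda>_. u)"]
      implicit_point_exists[OF D(1-4,6)] by metis
  have "Qmap D T (\<lambda>_. u) = q"
    unfolding Qmap_def by (rule tendsto_Lim[OF trivial_limit_at_right_real q(2)])
  with q show "Qmap D T (\<lambda>_. u) \<in> fixpoints D T"
    "(implicit_point D T (\<lambda>_. u) \<longlongrightarrow> Qmap D T (\<lambda>_. u)) (at_right 0)" by auto
qed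

text \<open>Norm version of limsup <u - q, J (x n - q)> \<le> 0, where J is the duality map.\<close>
lemma approximate_fixpoints_limsup:
  fixes x :: "nat \<Rightarrow> 'a::real_normed_vector"
  assumes T: "nonexpansive_on D T" and x: "\<And>n. x n \<in> D" "(\<lambda>n. norm (T (x n) - x n)) \<longlonglongrightarrow> 0"
    and X: "\<And>t. 0 < t \<Longrightarrow> t < 1 \<Longrightarrow> X t \<in> D"
      "\<And>t. 0 < t \<Longrightarrow> t < 1 \<Longrightarrow> X t = t *\<^sub>R u + (1 - t) *\<^sub>R T (X t)"
      "(X \<longlongrightarrow> q) (at_right 0)"
    and \<kappa>: "\<kappa> \<ge> 0" and e: "e > 0"
  shows "\<forall>\<^sub>F n in sequentially. norm (q - x n) - e \<le> norm ((q - x n) + \<kappa> *\<^sub>R (u - q))"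
proof -
  have "\<forall>\<^sub>F t in at_right 0. dist (X t) q < e / (2 * (2 + \<kappa>))"
    using X(3) \<kappa> e by (intro tendstoD) auto
  moreover have "\<forall>\<^sub>F t in at_right (0::real). 0 < t \<and> t < 1"
    using eventually_at_right_real[of 0 1] by simp
  ultimately have "\<forall>\<^sub>F t in at_right 0. dist (X t) q < e / (2 * (2 + \<kappa>)) \<and> 0 < t \<and> t < 1"
    by (rule eventually_conj)
  from eventually_happens'[OF trivial_limit_at_right_real this]
  obtain t where t: "norm (X t - q) < e / (2 * (2 + \<kappa>))" "0 < t" "t < 1"
    by (auto simp: dist_norm)
  \<comment> \<open>Replacing \<open>X t\<close> by \<open>q\<close> costs one multiple of this
    distance in \<open>norm (q - x n)\<close> and at most \<open>1 + \<kappa>\<close> multiples in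
    the displaced vector.\<close>
  have "(2 + \<kappa>) * norm (X t - q) < e / 2" using t \<kappa> by (simp add: field_simps)
  then have close: "norm (X t - q) + (1 + \<kappa>) * norm (X t - q) < e / 2" by (simp add: algebra_simps)
  \<comment> \<open>Here \<open>t\<close> is fixed before \<open>n\<close> grows, so the factor
    \<open>(1 - t) / t\<close> is a constant.\<close>
  have "(\<lambda>n. \<kappa> * ((1 - t) / t) * norm (T (x n) - x n)) \<longlonglongrightarrow> 0"
    by (rule tendsto_mult_right_zero[OF x(2)])
  then have "\<forall>\<^sub>F n in sequentially. \<kappa> * ((1 - t) / t) * norm (T (x n) - x n) < e / 2"
    using e by (intro order_tendstoD(2)) auto
  then show ?thesis
  proof eventually_elim
    case (elim n)
    have "norm (T (X t) - T (x n)) \<le> norm (X t - x n)"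
      using T X(1) x t by (auto simp: nonexpansive_on_def)
    then have "norm (X t - x n) - \<kappa> * ((1 - t) / t) * norm (T (x n) - x n) \<le> norm ((X t - x n) + \<kappa> *\<^sub>R (u - X t))"
      using X(2) t \<kappa> by (intro implicit_point_accretive) auto
    moreover have "(X t - x n) + \<kappa> *\<^sub>R (u - X t) = ((q - x n) + \<kappa> *\<^sub>R (u - q)) + (1 - \<kappa>) *\<^sub>R (X t - q)"
      by (simp add: algebra_simps)
    moreover have "norm ((1 - \<kappa>) *\<^sub>R (X t - q)) \<le> (1 + \<kappa>) * norm (X t - q)"
      using \<kappa> by (auto intro!: mult_right_mono)
    moreover have "norm (q - x n) \<le> norm (X t - x n) + norm (X t - q)"
      using norm_triangle_ineq4[of "X t - x n" "X t - q"] by simp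
    ultimately show ?case
      using elim close norm_triangle_ineq[of "(q - x n) + \<kappa> *\<^sub>R (u - q)" "(1 - \<kappa>) *\<^sub>R (X t - q)"] by simp
  qed
qed

section \<open>Norm estimates and convergence of the iteration\<close>

text \<open>\<open>b\<close> is a convex combination of \<open>b - \<alpha> *\<^sub>R p\<close> and
  \<open>b + \<kappa> *\<^sub>R p\<close> with weights proportional to \<kappa> and \<alpha>.
  Convexity of the norm thus transfers the growth rate from the one step \<kappa> to every backward
  step \<alpha>.\<close>

lemma norm_le_of_forward_growth:
  fixes b p :: "'a::real_normed_vector"
  assumes "norm (b + \<kappa> *\<^sub>R p) \<le> norm b + \<kappa> * c" "\<kappa> > 0" "\<alpha> \<ge> 0"
  shows "norm b \<le> norm (b - \<alpha> *\<^sub>R p) + \<alpha> * c"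
proof -
  have "(\<kappa> + \<alpha>) *\<^sub>R b = \<kappa> *\<^sub>R (b - \<alpha> *\<^sub>R p) + \<alpha> *\<^sub>R (b + \<kappa> *\<^sub>R p)" by (simp add: algebra_simps)
  then have "norm ((\<kappa> + \<alpha>) *\<^sub>R b) \<le> norm (\<kappa> *\<^sub>R (b - \<alpha> *\<^sub>R p)) + norm (\<alpha> *\<^sub>R (b + \<kappa> *\<^sub>R p))"
    using norm_triangle_ineq by metis
  then have "(\<kappa> + \<alpha>) * norm b \<le> \<kappa> * norm (b - \<alpha> *\<^sub>R p) + \<alpha> * norm (b + \<kappa> *\<^sub>R p)"
    using assms by simp
  also have "\<dots> \<le> \<kappa> * norm (b - \<alpha> *\<^sub>R p) + \<alpha> * (norm b + \<kappa> * c)"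
    using assms by (intro add_left_mono mult_left_mono)
  finally have "\<kappa> * norm b \<le> \<kappa> * (norm (b - \<alpha> *\<^sub>R p) + \<alpha> * c)" by (simp add: algebra_simps)
  then show ?thesis using assms by simp
qed

lemma norm_convex3_le:
  fixes a b c :: "'a::real_normed_vector"
  assumes "0 \<le> i" "0 \<le> j" "0 \<le> k"
  shows "norm (i *\<^sub>R a + j *\<^sub>R b + k *\<^sub>R c) \<le> i * norm a + j * norm b + k * norm c"
  using norm_triangle_ineq[of "i *\<^sub>R a + j *\<^sub>R b" "k *\<^sub>R c"] norm_triangle_ineq[of "i *\<^sub>R a" "j *\<^sub>R b"] assms
  by simp

lemma convexD3:
  assumes "convex D" "a \<in> D" "b \<in> D" "c \<in> D" "0 \<le> i" "0 \<le> j" "0 \<le> k" "i + j + k = 1"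
  shows "i *\<^sub>R a + j *\<^sub>R b + k *\<^sub>R c \<in> D"
proof (cases "i + j = 0")
  case True
  then have "i = 0" "j = 0" "k = 1" using assms by linarith+
  then show ?thesis using assms(4) by simp
next
  case False
  then have pos: "i + j > 0" using assms by linarith
  then have "i / (i + j) + j / (i + j) = 1" by (metis add_divide_distrib divide_self less_irrefl)
  with assms pos have "(i / (i + j)) *\<^sub>R a + (j / (i + j)) *\<^sub>R b \<in> D"
    by (intro convexD) auto
  then have "(i + j) *\<^sub>R ((i / (i + j)) *\<^sub>R a + (j / (i + j)) *\<^sub>R b) + k *\<^sub>R c \<in> D"
    using assms pos by (intro convexD[OF assms(1) _ assms(4)]) auto
  then show ?thesis using pos by (simp add: scaleR_add_right)
qed

theorem theorem3p2:
  fixes D :: "'a::banach set" and T :: "'a \<Rightarrow> 'a"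
    and u :: 'a and x y us vs :: "nat \<Rightarrow> 'a"
    and \<alpha> \<beta> \<gamma> \<delta> :: "nat \<Rightarrow> real"
  assumes "uniformly_smooth TYPE('a)"
    and "D \<noteq> {}" "closed D" "convex D"
    and "T ` D \<subseteq> D" "nonexpansive_on D T" "fixpoints D T \<noteq> {}"
    and "x 0 \<in> D" "u \<in> D"
    and "\<And>n. us n \<in> D" "\<And>n. vs n \<in> D" "bounded (range us)" "bounded (range vs)"
    and "\<And>n. \<alpha> n \<ge> 0" "\<And>n. \<beta> n \<ge> 0" "\<And>n. \<gamma> n \<ge> 0" "\<And>n. \<delta> n \<ge> 0"
    and "\<And>n. 0 < \<alpha> n + \<gamma> n \<and> \<alpha> n + \<gamma> n \<le> 1"
    and "\<And>n. 0 < \<beta> n + \<delta> n \<and> \<beta> n + \<delta> n \<le> 1"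
    and "\<alpha> \<longlonglongrightarrow> 0" "\<not> summable \<alpha>" "summable \<gamma>" "summable \<delta>"
    and "(\<lambda>n. \<gamma> n / (\<alpha> n + \<gamma> n)) \<longlonglongrightarrow> 0"
    and "\<And>n. y n = \<beta> n *\<^sub>R x n + (1 - \<beta> n - \<delta> n) *\<^sub>R T (x n) + \<delta> n *\<^sub>R vs n"
    and "\<And>n. x (Suc n) = \<alpha> n *\<^sub>R u + (1 - \<alpha> n - \<gamma> n) *\<^sub>R T (y n) + \<gamma> n *\<^sub>R us n"
    and "bounded (range x)"
    and "(\<lambda>n. norm (T (x n) - x n)) \<longlonglongrightarrow> 0"
  shows "x \<longlonglongrightarrow> Qmap D T (\<lambda>_. u)"
proof -
  note us = assms(1) and D = assms(3-7,9)
  note nonneg = assms(14-17)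
  have \<alpha>\<gamma>: "\<alpha> n + \<gamma> n \<le> 1" and \<beta>\<delta>: "\<beta> n + \<delta> n \<le> 1" for n using assms(18,19) by auto
  define q where "q = Qmap D T (\<lambda>_. u)"
  define p where "p = u - q"
  have q: "q \<in> D" "T q = q" and lim: "(implicit_point D T (\<lambda>_. u) \<longlongrightarrow> q) (at_right 0)"
    using uniformly_smooth_Qmap[OF us D] by (auto simp: q_def fixpoints_def)
  have xy: "y n \<in> D" if "x n \<in> D" for n
    unfolding assms(25) using that D(3) nonneg \<beta>\<delta>[of n] assms(11) by (intro convexD3[OF D(2)]) auto
  have xD: "x n \<in> D" for n
  proof (induction n)
    case (Suc n)
    then show ?case
      unfolding assms(26) using xy[of n] D(3) nonneg \<alpha>\<gamma>[of n] assms(9,10) by (intro convexD3[OF D(2)]) auto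
  qed (rule assms(8))
  have T: "norm (T a - q) \<le> norm (a - q)" if "a \<in> D" for a
    using D(4) q that unfolding nonexpansive_on_def by metis
  obtain B1 B2 where "\<And>n. norm (us n) \<le> B1" "\<And>n. norm (vs n) \<le> B2"
    using assms(12,13) by (auto simp: bounded_iff)
  define M where "M = max B1 B2 + norm q"
  have M: "norm (us n - q) \<le> M" "norm (vs n - q) \<le> M" for n
    using \<open>norm (us n) \<le> B1\<close> \<open>norm (vs n) \<le> B2\<close> norm_triangle_ineq4[of "us n" q] norm_triangle_ineq4[of "vs n" q]
    by (auto simp: M_def)
  have M0: "M \<ge> 0" using M(1)[of 0] norm_ge_zero order_trans by blast
  define s where "s n = norm (x n - q)" for n
  define e where "e n = M * (\<gamma> n + \<delta> n)" for n
  have y_le: "norm (y n - q) \<le> s n + \<delta> n * M" for n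
  proof -
    have "y n - q = \<beta> n *\<^sub>R (x n - q) + (1 - \<beta> n - \<delta> n) *\<^sub>R (T (x n) - q) + \<delta> n *\<^sub>R (vs n - q)"
      unfolding assms(25) by (simp add: algebra_simps)
    also have "norm \<dots> \<le> \<beta> n * norm (x n - q) + (1 - \<beta> n - \<delta> n) * norm (T (x n) - q) + \<delta> n * norm (vs n - q)"
      using nonneg \<beta>\<delta>[of n] by (intro norm_convex3_le) auto
    also have "\<dots> \<le> \<beta> n * s n + (1 - \<beta> n - \<delta> n) * s n + \<delta> n * M"
      unfolding s_def using nonneg \<beta>\<delta>[of n] T[OF xD[of n]] M by (intro add_mono mult_left_mono) auto
    also have "\<dots> = s n - \<delta> n * s n + \<delta> n * M" by (simp add: algebra_simps)
    also have "\<dots> \<le> s n + \<delta> n * M" using nonneg by (simp add: s_def)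
    finally show ?thesis .
  qed
  \<comment> \<open>Subtracting \<open>\<alpha> n *\<^sub>R p\<close> replaces \<open>u\<close> by
    \<open>q\<close>, so its term vanishes and the remaining weights sum to
    \<open>1 - \<alpha> n\<close>.\<close>
  have step: "norm ((x (Suc n) - q) - \<alpha> n *\<^sub>R p) \<le> (1 - \<alpha> n) * s n + e n" for n
  proof -
    have Ty: "norm (T (y n) - q) \<le> s n + \<delta> n * M"
      using T[OF xy[OF xD[of n]]] y_le[of n] by linarith
    have "(x (Suc n) - q) - \<alpha> n *\<^sub>R p
        = 0 *\<^sub>R 0 + (1 - \<alpha> n - \<gamma> n) *\<^sub>R (T (y n) - q) + \<gamma> n *\<^sub>R (us n - q)"
      unfolding assms(26) by (simp add: p_def algebra_simps)
    also have "norm \<dots> \<le> 0 * norm (0::'a) + (1 - \<alpha> n - \<gamma> n) * norm (T (y n) - q) + \<gamma> n * norm (us n - q)"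
      using nonneg \<alpha>\<gamma>[of n] by (intro norm_convex3_le) auto
    also have "\<dots> \<le> 0 * norm (0::'a) + (1 - \<alpha> n - \<gamma> n) * (s n + \<delta> n * M) + \<gamma> n * M"
      using nonneg \<alpha>\<gamma>[of n] Ty M by (intro add_mono mult_left_mono) auto
    also have "\<dots> = (1 - \<alpha> n) * s n + e n - (\<gamma> n * s n + (\<alpha> n + \<gamma> n) * (\<delta> n * M))"
      by (simp add: e_def algebra_simps)
    also have "\<dots> \<le> (1 - \<alpha> n) * s n + e n"
    proof -
      have "0 \<le> \<gamma> n * s n + (\<alpha> n + \<gamma> n) * (\<delta> n * M)"
        using nonneg M0 by (intro add_nonneg_nonneg mult_nonneg_nonneg) (auto simp: s_def)
      then show ?thesis by linarith
    qed
    finally show ?thesis .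
  qed
  have "s \<longlonglongrightarrow> 0"
  proof (rule perturbed_contraction_up_to_tolerance[where \<alpha> = \<alpha> and e = e])
    show "\<alpha> n \<le> 1" for n using \<alpha>\<gamma>[of n] nonneg(3)[of n] by linarith
    show "summable e" unfolding e_def using assms(22,23) by (intro summable_mult summable_add)
    fix c :: real assume c: "c > 0"
    define P where "P = norm p + 1"
    have P: "norm p \<le> P" "P > 0" unfolding P_def by (auto simp: add_nonneg_pos)
    obtain \<epsilon> where \<epsilon>: "\<epsilon> > 0"
      "\<And>(b::'a) z. norm z \<le> \<epsilon> * norm b \<Longrightarrow> norm (b + z) + norm (b - z) \<le> 2 * norm b + c / (2 * P) * norm z"
      using uniformly_smooth_scaled[OF us, of "c / (2 * P)"] c P by auto
    \<comment> \<open>Makes \<open>\<kappa> * norm p \<le> \<epsilon> * c\<close>, so smoothness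
      applies whenever \<open>norm b > c\<close>; the opposite case is the first entry of the
      maximum.\<close>
    define \<kappa> where "\<kappa> = \<epsilon> * c / P"
    have \<kappa>: "\<kappa> > 0" using \<epsilon> c P by (simp add: \<kappa>_def)
    have \<kappa>p: "\<kappa> * norm p \<le> \<kappa> * P" using \<kappa> P by (intro mult_left_mono) auto
    have "\<forall>\<^sub>F n in sequentially. norm (q - x n) - \<kappa> * c / 2 \<le> norm ((q - x n) + \<kappa> *\<^sub>R (u - q))"
      using \<kappa> c implicit_point_exists[OF D(1-4,6)]
      by (intro approximate_fixpoints_limsup[OF D(4) xD assms(28) _ _ lim]) auto
    \<comment> \<open>The direction estimate is needed at the new iterate, whence the index
      shift.\<close>
    then have "\<forall>\<^sub>F n in sequentially.
        norm (q - x (Suc n)) - \<kappa> * c / 2 \<le> norm ((q - x (Suc n)) + \<kappa> *\<^sub>R (u - q))"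
      by (subst eventually_sequentially_Suc)
    then show "\<forall>\<^sub>F n in sequentially. s (Suc n) \<le> max c ((1 - \<alpha> n) * s n + \<alpha> n * c + e n)"
    proof eventually_elim
      case (elim n)
      define b where "b = x (Suc n) - q"
      \<comment> \<open>Since \<open>q - x (Suc n)\<close> is \<open>- b\<close>, the estimate
        concerns the step \<open>- \<kappa> *\<^sub>R p\<close>; smoothness below turns it into an
        upper bound for the opposite step.\<close>
      have b: "norm b - \<kappa> * c / 2 \<le> norm (b - \<kappa> *\<^sub>R p)"
        using elim norm_minus_commute[of q "x (Suc n)"] norm_minus_commute[of b "\<kappa> *\<^sub>R p"]
        by (simp add: b_def p_def algebra_simps)
      show ?case
      proof (cases "norm b \<le> c")
        case True
        then show ?thesis by (simp add: s_def b_def)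
      next
        case False
        have "\<kappa> * P = \<epsilon> * c" using P by (simp add: \<kappa>_def)
        also have "\<dots> \<le> \<epsilon> * norm b" using False \<epsilon> by (intro mult_left_mono) auto
        finally have "norm (\<kappa> *\<^sub>R p) \<le> \<epsilon> * norm b"
          unfolding norm_scaleR abs_of_pos[OF \<kappa>] using \<kappa>p by linarith
        then have "norm (b + \<kappa> *\<^sub>R p) + norm (b - \<kappa> *\<^sub>R p) \<le> 2 * norm b + c / (2 * P) * norm (\<kappa> *\<^sub>R p)"
          by (rule \<epsilon>(2))
        moreover have "c / (2 * P) * norm (\<kappa> *\<^sub>R p) \<le> c / (2 * P) * (\<kappa> * P)"
          using \<kappa>p \<kappa> c P by (intro mult_left_mono) auto
        moreover have "c / (2 * P) * (\<kappa> * P) = \<kappa> * c / 2" using P by simp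
        \<comment> \<open>The smoothness error and the direction error contribute
          \<open>\<kappa> * c / 2\<close> each.\<close>
        ultimately have "norm (b + \<kappa> *\<^sub>R p) \<le> norm b + \<kappa> * c" using b by linarith
        from norm_le_of_forward_growth[OF this \<kappa> nonneg(1)]
        have "norm b \<le> norm (b - \<alpha> n *\<^sub>R p) + \<alpha> n * c" .
        with step[of n] show ?thesis by (simp add: b_def s_def)
      qed
    qed
  qed (use nonneg assms(21) M0 in \<open>auto simp: s_def e_def\<close>)
  then show ?thesis
    unfolding s_def q_def[symmetric] by (simp add: tendsto_norm_zero_iff LIM_zero_iff)
qed

end
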